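(* Let $d\ge 2$. Let $\Psi\in L_1(\mathbb{R}^d)\cap L_2(\mathbb{R}^d)$ be an admissible shearlet and let $\Phi\in L_1(\mathbb{R}^d)\cap L_2(\mathbb{R}^d)$ be such that $$\int_{\mathbb{R}^{d-1}}\frac{|\hat\Phi(y,\sigma)|^2}{|y|^{d-1}}\,d\sigma+\int_{\mathbb{R}^{d-1}}\int_{-|y|}^{|y|}\frac{|\hat\Psi(\xi_1,\tilde\xi)|^2}{|\xi_1|^d}\,d\xi_1\,d\tilde\xi=1\quad\text{for almost every }y\in\mathbb{R}.$$ Then the inhomogeneous shearlet system $\mathfrak{F}=\{\psi_x\}_{x\in X}$ generated by $\Phi,\Psi$ is a continuous Parseval frame of $L_2(\mathbb{R}^d)$, i.e. $$\int_X|\langle f,\psi_x\rangle|^2\,d\mu(x)=\|f\|_{L_2(\mathbb{R}^d)}^2\quad\text{for all } f\in L_2(\mathbb{R}^d).$$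
   Context: Fourier transform: $\hat f(\omega)=\int_{\mathbb{R}^d}f(x)e^{-2\pi i\omega\cdot x}\,dx$, extended to $L_2(\mathbb{R}^d)$. A function $\Psi\in L_2(\mathbb{R}^d)$ is an admissible shearlet if $\int_{\mathbb{R}^d}|\hat\Psi(\omega)|^2|\omega_1|^{-d}\,d\omega<\infty$. For $a\in\mathbb{R}\setminus\{0\}$ let $A_a=\begin{pmatrix}a&0\\0&\operatorname{sign}(a)|a|^{1/d}I_{d-1}\end{pmatrix}$ and for $s\in\mathbb{R}^{d-1}$ let $S_s=\begin{pmatrix}1&s^T\\0&I_{d-1}\end{pmatrix}$ ($d\times d$ matrices). Parameter space: $X=(\{\infty\}\times\mathbb{R}^{d-1}\times\mathbb{R}^d)\cup([-1,1]^*\times\mathbb{R}^{d-1}\times\mathbb{R}^d)$, where $[-1,1]^*=[-1,1]\setminus\{0\}$ and $\infty$ is an isolated point, with the Borel measure $\mu$ given by $$\int_XF\,d\mu=\int_{\mathbb{R}^d}\int_{\mathbb{R}^{d-1}}F(\infty,s,t)\,ds\,dt+\int_{\mathbb{R}^d}\int_{\mathbb{R}^{d-1}}\int_{-1}^1F(a,s,t)\,\frac{da}{|a|^{d+1}}\,ds\,dt.$$ The system $\mathfrak{F}=\{\psi_x\}_{x\in X}$ generated by $\Phi,\Psi$ is $\psi_{(\infty,s,t)}=\Phi(S_s^{-1}(\cdot-t))$ and $\psi_{(a,s,t)}=|\det A_a|^{-1/2}\,\Psi(A_a^{-1}S_s^{-1}(\cdot-t))$ for $a\in[-1,1]^*$.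 *)

theory Defs
  imports "HOL-Analysis.Analysis"
begin

text \<open>
  Throughout, \<open>'n\<close> indexes the coordinates of \<open>\<real>\<^sup>d\<^sup>-\<^sup>1\<close> and \<open>'n option\<close> those of \<open>\<real>\<^sup>d\<close>, the
  distinguished first coordinate being \<open>None\<close>. So \<open>d = CARD('n option) = CARD('n) + 1\<close>; as \<open>'n\<close>
  is an arbitrary nonempty finite type, \<open>d\<close> ranges over all integers \<open>\<ge> 2\<close>.
\<close>

definition vec_cons :: "real \<Rightarrow> real ^ 'n \<Rightarrow> real ^ 'n option" where
  "vec_cons y v = (\<chi> i. case i of None \<Rightarrow> y | Some k \<Rightarrow> v $ k)"

section \<open>Function spaces and the Fourier transform\<close>

text \<open>Elements of $L_1$, $L_2$ are represented by Lebesgue measurable functions.\<close>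

definition L1 :: "('a::euclidean_space \<Rightarrow> complex) set" where
  "L1 = {f. integrable lebesgue f}"

definition L2 :: "('a::euclidean_space \<Rightarrow> complex) set" where
  "L2 = {f. f \<in> borel_measurable lebesgue \<and> integrable lebesgue (\<lambda>x. (cmod (f x))\<^sup>2)}"

definition L2_inner :: "('a::euclidean_space \<Rightarrow> complex) \<Rightarrow> ('a \<Rightarrow> complex) \<Rightarrow> complex" where
  "L2_inner f g = (\<integral>x. f x * cnj (g x) \<partial>lebesgue)"

definition L2_norm :: "('a::euclidean_space \<Rightarrow> complex) \<Rightarrow> real" where
  "L2_norm f = sqrt (\<integral>x. (cmod (f x))\<^sup>2 \<partial>lebesgue)"

definition fourier_L1 :: "('a::euclidean_space \<Rightarrow> complex) \<Rightarrow> 'a \<Rightarrow> complex" where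
  "fourier_L1 f \<omega> = (\<integral>x. f x * exp (- 2 * of_real pi * \<i> * of_real (\<omega> \<bullet> x)) \<partial>lebesgue)"

text \<open>
  \<open>g\<close> is a Fourier transform of \<open>f \<in> L2\<close>, in the sense of the continuous extension from
  $L_1 \cap L_2$; by Plancherel such a \<open>g\<close> exists and is unique up to null sets.
\<close>

definition is_fourier_L2 ::
  "('a::euclidean_space \<Rightarrow> complex) \<Rightarrow> ('a \<Rightarrow> complex) \<Rightarrow> bool" where
  "is_fourier_L2 f g \<longleftrightarrow> f \<in> L2 \<and> g \<in> L2 \<and>
     (\<exists>u. (\<forall>n. u n \<in> L1 \<inter> L2) \<and>
       (\<lambda>n::nat. \<integral>\<^sup>+x. ennreal ((cmod (u n x - f x))\<^sup>2) \<partial>lebesgue) \<longlonglongrightarrow> 0 \<and>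
       (\<lambda>n. \<integral>\<^sup>+\<omega>. ennreal ((cmod (fourier_L1 (u n) \<omega> - g \<omega>))\<^sup>2) \<partial>lebesgue) \<longlonglongrightarrow> 0)"

definition fourier :: "('a::euclidean_space \<Rightarrow> complex) \<Rightarrow> 'a \<Rightarrow> complex" where
  "fourier f = (if f \<in> L1 then fourier_L1 f else (SOME g. is_fourier_L2 f g))"

definition admissible_shearlet :: "(real ^ 'n::finite option \<Rightarrow> complex) \<Rightarrow> bool" where
  "admissible_shearlet \<Psi> \<longleftrightarrow> \<Psi> \<in> L2 \<and>
     (\<integral>\<^sup>+\<omega>. ennreal ((cmod (fourier \<Psi> \<omega>))\<^sup>2 / \<bar>\<omega> $ None\<bar> ^ CARD('n option)) \<partial>lebesgue) < \<infinity>"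

section \<open>Dilation and shear matrices\<close>

definition dilation_matrix :: "real \<Rightarrow> real ^ 'n::finite option ^ 'n option" where
  "dilation_matrix a = (\<chi> i j. case (i, j) of
       (None, None) \<Rightarrow> a
     | (None, Some l) \<Rightarrow> 0
     | (Some k, None) \<Rightarrow> 0
     | (Some k, Some l) \<Rightarrow>
         if k = l then sgn a * \<bar>a\<bar> powr (1 / real CARD('n option)) else 0)"

definition shear_matrix :: "real ^ 'n::finite \<Rightarrow> real ^ 'n option ^ 'n option" where
  "shear_matrix s = (\<chi> i j. case (i, j) of
       (None, None) \<Rightarrow> 1
     | (None, Some l) \<Rightarrow> s $ l
     | (Some k, None) \<Rightarrow> 0
     | (Some k, Some l) \<Rightarrow> if k = l then 1 else 0)"

section \<open>The parameter space\<close>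

text \<open>
  The scale lives in the extended reals: the point \<open>\<infinity>\<close> is isolated in the subspace
  \<open>{\<infinity>} \<union> ereal ` ({-1..1} - {0})\<close>, so \<open>X\<close> carries the subspace topology.
\<close>

type_synonym 'n param = "ereal \<times> (real ^ 'n) \<times> (real ^ 'n option)"

definition param_space :: "('n::finite param) set" where
  "param_space = ({\<infinity>} \<times> UNIV \<times> UNIV) \<union> (ereal ` ({-1..1} - {0}) \<times> UNIV \<times> UNIV)"

definition param_integral :: "('n::finite param \<Rightarrow> ennreal) \<Rightarrow> ennreal" where
  "param_integral F =
     (\<integral>\<^sup>+t. \<integral>\<^sup>+s. F (\<infinity>, s, t) \<partial>lborel \<partial>lborel) +
     (\<integral>\<^sup>+t. \<integral>\<^sup>+s. (\<integral>\<^sup>+a\<in>{-1..1} - {0}.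
        F (ereal a, s, t) * ennreal (1 / \<bar>a\<bar> ^ (CARD('n option) + 1)) \<partial>lborel) \<partial>lborel \<partial>lborel)"

definition param_measure :: "('n::finite param) measure" where
  "param_measure = measure_of param_space (sets (restrict_space borel param_space))
     (\<lambda>E. param_integral (indicator E))"

lemma sets_param_space: "param_space \<in> sets (borel :: ('n::finite param) measure)"
proof -
  have eq: "ereal ` ({-1..1} - {0}) = {ereal (-1)..ereal 1} - {0}"
  proof (intro set_eqI iffI)
    fix x assume "x \<in> {ereal (-1)..ereal 1} - {0}"
    then show "x \<in> ereal ` ({-1..1} - {0})"
      by (cases x) auto
  qed auto
  have "{\<infinity>::ereal} \<times> UNIV \<times> UNIV \<in> sets (borel :: ('n param) measure)"
    by (intro borel_closed closed_Times) auto
  moreover have "{ereal (-1)..ereal 1} \<times> UNIV \<times> UNIV \<in> sets (borel :: ('n param) measure)"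
    by (intro borel_closed closed_Times) auto
  moreover have "{0::ereal} \<times> UNIV \<times> UNIV \<in> sets (borel :: ('n param) measure)"
    by (intro borel_closed closed_Times) auto
  moreover have "(param_space :: ('n param) set) = ({\<infinity>} \<times> UNIV \<times> UNIV) \<union>
      (({ereal (-1)..ereal 1} \<times> UNIV \<times> UNIV) - ({0} \<times> UNIV \<times> UNIV))"
    unfolding param_space_def eq by auto
  ultimately show ?thesis by (metis sets.Un sets.Diff)
qed

lemma space_param_measure: "space param_measure = param_space"
  unfolding param_measure_def
  by (rule space_measure_of) (use sets.space_closed[of "restrict_space borel param_space"]
      in \<open>simp add: space_restrict_space\<close>)

lemma sets_param_measure:
  "sets (param_measure :: ('n::finite param) measure) = sets (restrict_space borel param_space)"
proof -
  have "sigma_sets param_space (sets (restrict_space borel (param_space :: ('n param) set))) =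
      sets (restrict_space borel param_space)"
    using sets.sigma_sets_eq[of "restrict_space borel (param_space :: ('n param) set)"]
    by (simp add: space_restrict_space)
  moreover have "sets (restrict_space borel (param_space :: ('n param) set)) \<subseteq> Pow param_space"
    using sets.space_closed[of "restrict_space borel (param_space :: ('n param) set)"]
    by (simp add: space_restrict_space)
  ultimately show ?thesis
    unfolding param_measure_def by (simp add: sets_measure_of)
qed

lemma param_integral_as_nn_integral:
  obtains M N :: "('n::finite param) measure" where "sets M = sets borel" "sets N = sets borel"
    "\<And>F. F \<in> borel_measurable borel \<Longrightarrow> param_integral F = nn_integral M F + nn_integral N F"
proof -
  let ?L1 = "lborel :: (real ^ 'n option) measure" and ?L2 = "lborel :: (real ^ 'n) measure"
  let ?g = "(\<lambda>p. (\<infinity>, snd p, fst p)) :: _ \<Rightarrow> 'n param"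
  let ?h = "(\<lambda>p. (ereal (snd p), snd (fst p), fst (fst p))) :: _ \<Rightarrow> 'n param"
  let ?w = "\<lambda>a::real. ennreal (1 / \<bar>a\<bar> ^ (CARD('n option) + 1)) * indicator ({-1..1} - {0}) a"
  let ?D = "density ((?L1 \<Otimes>\<^sub>M ?L2) \<Otimes>\<^sub>M (lborel :: real measure)) (\<lambda>(p, a). ?w a)"
  have g[measurable]: "?g \<in> measurable (?L1 \<Otimes>\<^sub>M ?L2) borel"
    unfolding borel_prod[symmetric] by measurable
  have h[measurable]: "?h \<in> measurable ((?L1 \<Otimes>\<^sub>M ?L2) \<Otimes>\<^sub>M (lborel :: real measure)) borel"
    unfolding borel_prod[symmetric] by measurable
  show thesis
  proof (rule that[of "distr (?L1 \<Otimes>\<^sub>M ?L2) borel ?g" "distr ?D borel ?h"])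
    fix F :: "'n param \<Rightarrow> ennreal" assume F[measurable]: "F \<in> borel_measurable borel"
    have g': "(\<lambda>p. F (?g p)) \<in> borel_measurable (?L1 \<Otimes>\<^sub>M ?L2)"
      and h': "(\<lambda>p. F (?h p)) \<in> borel_measurable ((?L1 \<Otimes>\<^sub>M ?L2) \<Otimes>\<^sub>M (lborel :: real measure))"
      using measurable_compose[OF g F] measurable_compose[OF h F] by simp_all
    have w[measurable]: "?w \<in> borel_measurable borel" by measurable
    have hw: "(\<lambda>(p, a). ?w a * F (?h (p, a)))
        \<in> borel_measurable ((?L1 \<Otimes>\<^sub>M ?L2) \<Otimes>\<^sub>M (lborel :: real measure))"
      using h' by (simp add: case_prod_beta') measurable
    have "nn_integral (distr (?L1 \<Otimes>\<^sub>M ?L2) borel ?g) F = (\<integral>\<^sup>+p. F (?g p) \<partial>(?L1 \<Otimes>\<^sub>M ?L2))"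
      by (intro nn_integral_distr g) simp
    also have "\<dots> = (\<integral>\<^sup>+t. \<integral>\<^sup>+s. F (\<infinity>, s, t) \<partial>lborel \<partial>lborel)"
      using lborel.nn_integral_fst[OF g'] by simp
    finally have 1: "nn_integral (distr (?L1 \<Otimes>\<^sub>M ?L2) borel ?g) F =
      (\<integral>\<^sup>+t. \<integral>\<^sup>+s. F (\<infinity>, s, t) \<partial>lborel \<partial>lborel)" .
    have "nn_integral (distr ?D borel ?h) F = (\<integral>\<^sup>+p. F (?h p) \<partial>?D)"
      by (intro nn_integral_distr) (use h in simp_all)
    also have "\<dots> = (\<integral>\<^sup>+p. (case p of (p, a) \<Rightarrow> ?w a * F (?h (p, a)))
        \<partial>((?L1 \<Otimes>\<^sub>M ?L2) \<Otimes>\<^sub>M (lborel :: real measure)))"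
      by (subst nn_integral_density[OF _ h']) (auto simp: case_prod_beta' intro!: nn_integral_cong)
    also have "\<dots> = (\<integral>\<^sup>+p. \<integral>\<^sup>+a. ?w a * F (?h (p, a)) \<partial>lborel \<partial>(?L1 \<Otimes>\<^sub>M ?L2))"
      using lborel.nn_integral_fst[OF hw] by simp
    also have "\<dots> = (\<integral>\<^sup>+t. \<integral>\<^sup>+s. \<integral>\<^sup>+a. ?w a * F (?h ((t, s), a)) \<partial>lborel \<partial>lborel \<partial>lborel)"
      using lborel.nn_integral_fst[OF lborel.borel_measurable_nn_integral_fst[OF hw]] by simp
    also have "\<dots> = (\<integral>\<^sup>+t. \<integral>\<^sup>+s. (\<integral>\<^sup>+a\<in>{-1..1} - {0}.
        F (ereal a, s, t) * ennreal (1 / \<bar>a\<bar> ^ (CARD('n option) + 1)) \<partial>lborel) \<partial>lborel \<partial>lborel)"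
      by (simp add: mult_ac)
    finally show "param_integral F =
        nn_integral (distr (?L1 \<Otimes>\<^sub>M ?L2) borel ?g) F + nn_integral (distr ?D borel ?h) F"
      unfolding param_integral_def 1 by simp
  qed simp_all
qed

text \<open>The set function defining \<open>param_measure\<close> is indeed a measure, and integration against it
  is given by \<open>param_integral\<close>.\<close>

lemma emeasure_param_measure:
  assumes "E \<in> sets (param_measure :: ('n::finite param) measure)"
  shows "emeasure param_measure E = param_integral (indicator E)"
proof -
  obtain M N :: "('n param) measure" where MN[measurable_cong, simp]: "sets M = sets borel" "sets N = sets borel"
    and eq: "\<And>F. F \<in> borel_measurable borel \<Longrightarrow> param_integral F = nn_integral M F + nn_integral N F"
    using param_integral_as_nn_integral by blast
  have sub: "A \<in> sets borel" if "A \<in> sets (param_measure :: ('n param) measure)" for A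
    using that by (simp add: sets_param_measure sets_restrict_space_iff sets_param_space)
  have val: "param_integral (indicator A) = emeasure M A + emeasure N A"
    if "A \<in> sets (param_measure :: ('n param) measure)" for A
    using sub[OF that] by (subst eq) auto
  show ?thesis
  proof (rule emeasure_measure_of[OF param_measure_def _ _ _ assms])
    show "sets (restrict_space borel (param_space :: ('n param) set)) \<subseteq> Pow param_space"
      using sets.space_closed[of "restrict_space borel (param_space :: ('n param) set)"]
      by (simp add: space_restrict_space)
    show "positive (sets param_measure) (\<lambda>E. param_integral (indicator E :: 'n param \<Rightarrow> ennreal))"
      by (simp add: positive_def val)
    show "countably_additive (sets param_measure) (\<lambda>E. param_integral (indicator E :: 'n param \<Rightarrow> ennreal))"
    proof (rule countably_additiveI)
      fix A :: "nat \<Rightarrow> 'n param set"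
      assume A: "range A \<subseteq> sets param_measure" "disjoint_family A" "\<Union> (range A) \<in> sets param_measure"
      have "(\<Sum>i. param_integral (indicator (A i))) = (\<Sum>i. emeasure M (A i) + emeasure N (A i))"
        using A by (intro suminf_cong val) auto
      also have "\<dots> = (\<Sum>i. emeasure M (A i)) + (\<Sum>i. emeasure N (A i))"
        by (rule suminf_add[symmetric]) auto
      also have "\<dots> = emeasure M (\<Union> (range A)) + emeasure N (\<Union> (range A))"
        using A sub by (subst (1 2) suminf_emeasure) auto
      finally show "(\<Sum>i. param_integral (indicator (A i))) = param_integral (indicator (\<Union> (range A)))"
        using val[OF A(3)] by simp
    qed
  qed
qed

lemma nn_integral_param_measure:
  fixes F :: "'n::finite param \<Rightarrow> ennreal"
  assumes "F \<in> borel_measurable param_measure"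
  shows "(\<integral>\<^sup>+x. F x \<partial>param_measure) = param_integral F"
proof -
  obtain M N :: "('n param) measure" where MN[measurable_cong, simp]: "sets M = sets borel" "sets N = sets borel"
    and eq: "\<And>F. F \<in> borel_measurable borel \<Longrightarrow> param_integral F = nn_integral M F + nn_integral N F"
    using param_integral_as_nn_integral by blast
  let ?X = "param_space :: ('n param) set"
  let ?P = "param_measure :: ('n param) measure"
  have X: "?X \<in> sets borel" by (rule sets_param_space)
  have cut: "param_integral G = param_integral (\<lambda>x. G x * indicator ?X x)" for G :: "'n param \<Rightarrow> ennreal"
    unfolding param_integral_def
    by (auto simp: param_space_def indicator_def intro!: arg_cong2[where f="(+)"] nn_integral_cong)
  have meas: "(\<lambda>x. G x * indicator ?X x) \<in> borel_measurable borel"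
    if "G \<in> borel_measurable ?P" for G :: "'n param \<Rightarrow> ennreal"
  proof -
    have "G \<in> borel_measurable (restrict_space borel ?X)"
      using that measurable_cong_sets[OF sets_param_measure refl] by blast
    then show ?thesis
      using X by (simp add: borel_measurable_restrict_space_iff_ennreal)
  qed
  have eq': "param_integral G =
      (\<integral>\<^sup>+x. G x * indicator ?X x \<partial>M) + (\<integral>\<^sup>+x. G x * indicator ?X x \<partial>N)"
    if "G \<in> borel_measurable ?P" for G
    by (subst cut, subst eq) (use meas[OF that] in auto)
  show ?thesis
    using assms
  proof (induction rule: borel_measurable_induct)
    case (cong f g)
    have "param_integral f = param_integral g"
      by (subst (1 2) cut)
        (rule arg_cong[where f=param_integral], use cong in \<open>auto simp: space_param_measure indicator_def\<close>)
    moreover have "(\<integral>\<^sup>+x. f x \<partial>?P) = (\<integral>\<^sup>+x. g x \<partial>?P)"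
      using cong by (intro nn_integral_cong) auto
    ultimately show ?case using cong by simp
  next
    case (set A)
    then show ?case by (simp add: emeasure_param_measure)
  next
    case (mult u c)
    have m: "(\<lambda>x. u x * indicator ?X x) \<in> borel_measurable borel"
      using meas mult by blast
    have "(\<lambda>x. c * u x) \<in> borel_measurable ?P" using mult by measurable
    from eq'[OF this] show ?case
      using mult m by (simp add: nn_integral_cmult eq' mult.assoc distrib_left)
  next
    case (add u v)
    have m: "(\<lambda>x. u x * indicator ?X x) \<in> borel_measurable borel"
      "(\<lambda>x. v x * indicator ?X x) \<in> borel_measurable borel"
      using meas add by blast+
    have "(\<lambda>x. v x + u x) \<in> borel_measurable ?P" using add by measurable
    from eq'[OF this] show ?case
      using add m by (simp add: nn_integral_add eq' distrib_right add_ac)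
  next
    case (seq U)
    have m: "\<And>i. (\<lambda>x. U i x * indicator ?X x) \<in> borel_measurable borel"
      using meas seq by blast
    have inc: "incseq (\<lambda>i x. U i x * indicator ?X x)"
      using seq(3) by (auto simp: incseq_def le_fun_def intro!: mult_right_mono)
    have F: "(\<lambda>x. (SUP i. U i) x) \<in> borel_measurable ?P"
      using seq by (simp add: image_comp)
    have S: "(SUP i. U i) x * indicator ?X x = (SUP i. U i x * indicator ?X x)" for x
      by (simp add: SUP_mult_right_ennreal image_comp)
    have "(\<integral>\<^sup>+x. (SUP i. U i) x \<partial>?P) = (SUP i. \<integral>\<^sup>+x. U i x \<partial>?P)"
      using seq by (simp add: nn_integral_monotone_convergence_SUP image_comp)
    also have "\<dots> = (SUP i. (\<integral>\<^sup>+x. U i x * indicator ?X x \<partial>M) + (\<integral>\<^sup>+x. U i x * indicator ?X x \<partial>N))"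
      using seq by (simp add: eq')
    also have "\<dots> = (SUP i. \<integral>\<^sup>+x. U i x * indicator ?X x \<partial>M) + (SUP i. \<integral>\<^sup>+x. U i x * indicator ?X x \<partial>N)"
      using inc by (intro ennreal_SUP_add) (auto simp: incseq_def le_fun_def intro!: nn_integral_mono)
    also have "\<dots> = param_integral (SUP i. U i)"
      using m inc unfolding eq'[OF F] S
      by (subst (1 2) nn_integral_monotone_convergence_SUP) (auto simp: measurable_def cong: measurable_cong_sets)
    finally show ?case .
  qed
qed

section \<open>Shearlet systems and Parseval frames\<close>

fun shearlet_system ::
  "(real ^ 'n::finite option \<Rightarrow> complex) \<Rightarrow> (real ^ 'n option \<Rightarrow> complex) \<Rightarrow>
    'n param \<Rightarrow> real ^ 'n option \<Rightarrow> complex" where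
  "shearlet_system \<Phi> \<Psi> (\<alpha>, s, t) = (\<lambda>x.
     if \<alpha> = \<infinity> then \<Phi> (matrix_inv (shear_matrix s) *v (x - t))
     else let A = dilation_matrix (real_of_ereal \<alpha>) in
       of_real (\<bar>det A\<bar> powr (-1/2)) *
         \<Psi> (matrix_inv A *v (matrix_inv (shear_matrix s) *v (x - t))))"

text \<open>\<open>has_bochner_integral\<close> asserts measurability and finiteness as well as the value of the integral.\<close>

definition continuous_parseval_frame ::
  "'x measure \<Rightarrow> ('x \<Rightarrow> 'a::euclidean_space \<Rightarrow> complex) \<Rightarrow> bool" where
  "continuous_parseval_frame M \<psi> \<longleftrightarrow>
     (\<forall>x\<in>space M. \<psi> x \<in> L2) \<and>
     (\<forall>f\<in>L2. has_bochner_integral M (\<lambda>x. (cmod (L2_inner f (\<psi> x)))\<^sup>2) ((L2_norm f)\<^sup>2))"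

end

theory Submission
  imports Defs "HOL-Probability.Characteristic_Functions"
begin

text \<open>
  For fixed \<open>(a, s)\<close> the coefficient \<open>t \<mapsto> \<langle>f, \<psi>\<rangle>\<close> is a correlation of \<open>f\<close> with a sheared and dilated
  generator, so Plancherel turns its squared norm into the integral of \<open>\<bar>f^\<bar>\<^sup>2\<close> against
  \<open>\<bar>\<Psi>^(A\<^sup>T S\<^sup>T \<omega>)\<bar>\<^sup>2\<close>; integrating over \<open>s\<close> and \<open>a\<close> and substituting, Tonelli leaves \<open>\<bar>f^\<bar>\<^sup>2\<close>
  times the normalisation hypothesis at \<open>y = \<omega>\<^sub>1\<close>, which is 1. Only \<open>f\<close> bounded, continuous and
  integrable is needed here: then the correlation is of the same kind, and Plancherel for such functions
  follows from Gaussian summability by dominated convergence. Such \<open>f\<close> are dense in \<open>L\<^sub>2\<close>, and the isometry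
  extends to all of \<open>L\<^sub>2\<close>.
\<close>

section \<open>Gaussians and changes of variables\<close>

text \<open>Two obstacles shape the setup. First, Tonelli in \<open>(t, s, a, y)\<close> needs joint
  measurability, and composition with the shear maps preserves Borel but not obviously Lebesgue
  measurability. So everything up to the end is done for Borel functions over \<open>lborel\<close>;
  the given \<open>f\<close>, \<Phi>, \<Psi> are replaced by Borel representatives, which alters
  neither the coefficients nor the transforms of the generators. Second, a direct use of Plancherel
  for arbitrary square-integrable \<open>f\<close> would involve correlations that are merely
  square-integrable. With \<open>f\<close> bounded, continuous and integrable and the generator
  integrable, every transform is an absolutely convergent integral, defined at each frequency.

  Correction: the IDEA comment above contains a stray symbol, so the complete list below replaces
  it.\<close>

lemma nn_integral_lborel_transform:
  fixes T :: "'a::euclidean_space \<Rightarrow> 'a"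
  assumes "lborel = density (distr lborel borel T) (\<lambda>_. ennreal c)"
    and [measurable]: "T \<in> borel_measurable borel" "f \<in> borel_measurable borel"
  shows "(\<integral>\<^sup>+x. f x \<partial>lborel) = ennreal c * (\<integral>\<^sup>+x. f (T x) \<partial>lborel)"
  by (subst assms(1)) (simp add: nn_integral_density nn_integral_distr nn_integral_cmult)

lemma integral_lborel_transform:
  fixes T :: "'a::euclidean_space \<Rightarrow> 'a" and f :: "'a \<Rightarrow> 'b::{banach, second_countable_topology}"
  assumes "lborel = density (distr lborel borel T) (\<lambda>_. ennreal c)" "0 \<le> c"
    and [measurable]: "T \<in> borel_measurable borel" "f \<in> borel_measurable borel"
  shows "(\<integral>x. f x \<partial>lborel) = c *\<^sub>R (\<integral>x. f (T x) \<partial>lborel)"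
  by (subst assms(1)) (use assms(2) in \<open>simp add: integral_density integral_distr\<close>)

lemma integrable_lborel_transform:
  fixes T :: "'a::euclidean_space \<Rightarrow> 'a" and f :: "'a \<Rightarrow> 'b::{banach, second_countable_topology}"
  assumes "lborel = density (distr lborel borel T) (\<lambda>_. ennreal c)" "0 < c"
    and [measurable]: "T \<in> borel_measurable borel" "f \<in> borel_measurable borel"
  shows "integrable lborel f \<longleftrightarrow> integrable lborel (\<lambda>x. f (T x))"
  using nn_integral_lborel_transform[OF assms(1,3), of "\<lambda>x. ennreal (norm (f x))"] assms(2)
  by (auto simp: integrable_iff_bounded ennreal_mult_less_top ennreal_mult_eq_top_iff less_top[symmetric])

text \<open>Up to the factor \<open>c > 0\<close>, the image of \<open>lborel\<close> under
  \<open>T\<close> is \<open>lborel\<close> itself, so preimages of null sets are null.\<close>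

lemma AE_lborel_transform:
  fixes T :: "'a::euclidean_space \<Rightarrow> 'a"
  assumes "lborel = density (distr lborel borel T) (\<lambda>_. ennreal c)" "0 < c"
    and T[measurable]: "T \<in> borel_measurable borel" and "AE x in lborel. P x"
  shows "AE x in lborel. P (T x)"
proof -
  obtain N where N: "N \<in> null_sets lborel" "{x. \<not> P x} \<subseteq> N"
    using assms(4) by (auto simp: eventually_ae_filter)
  then have [measurable]: "N \<in> sets borel" by (auto simp: null_sets_def)
  have "AE x in density (distr lborel borel T) (\<lambda>_. ennreal c). x \<notin> N"
    using AE_not_in[OF N(1)] assms(1) by metis
  then have "AE x in lborel. T x \<notin> N"
    using assms(2) by (simp add: AE_density AE_distr_iff)
  then show ?thesis
    by eventually_elim (use N(2) in auto)
qed

lemma lborel_scale: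
  assumes "c \<noteq> 0"
  shows "lborel = density (distr lborel borel (\<lambda>x::'a::euclidean_space. t + c *\<^sub>R x)) (\<lambda>_. ennreal (\<bar>c\<bar> ^ DIM('a)))"
  using lborel_affine[OF assms, of t] by (simp add: ennreal_power)

section \<open>The Fourier kernel as a unimodular character, and the Gaussian\<close>

definition fker :: "real \<Rightarrow> complex" where
  "fker r = cis (- (2 * pi * r))"

lemma fker_measurable[measurable]: "fker \<in> borel_measurable borel"
  unfolding fker_def cis_conv_exp by measurable

lemma norm_fker[simp]: "cmod (fker r) = 1"
  by (simp add: fker_def)

lemma fker_add: "fker (r + q) = fker r * fker q"
  by (simp add: fker_def cis_mult algebra_simps)

lemma fker_minus: "fker (- r) = cnj (fker r)"
  by (simp add: fker_def cis_cnj)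

text \<open>Completion does not change the integral of a Borel function. This moves the transform to
  \<open>lborel\<close>, where product measures and Fubini are available.\<close>

lemma fourier_L1_lborel:
  assumes [measurable]: "f \<in> borel_measurable borel"
  shows "fourier_L1 f \<omega> = (\<integral>x. f x * fker (\<omega> \<bullet> x) \<partial>lborel)"
proof -
  have "exp (- 2 * of_real pi * \<i> * of_real r) = fker r" for r
    by (simp add: fker_def cis_conv_exp mult_ac)
  then show ?thesis unfolding fourier_L1_def
    by (simp add: integral_completion)
qed

text \<open>A null set is invisible to each defining integral, so the transforms agree at every
  frequency. The normalisation hypothesis, which integrates over hyperplanes, can therefore be
  rewritten directly.\<close>

lemma fourier_L1_cong_AE:
  assumes "f \<in> borel_measurable lebesgue" "g \<in> borel_measurable lebesgue" "AE x in lborel. f x = g x"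
  shows "fourier_L1 f = fourier_L1 g"
proof
  have k: "(\<lambda>x. exp (- 2 * of_real pi * \<i> * of_real (\<omega> \<bullet> x))) \<in> borel_measurable lebesgue" for \<omega> :: 'a
    by (intro measurable_completion) measurable
  show "fourier_L1 f \<omega> = fourier_L1 g \<omega>" for \<omega>
    unfolding fourier_L1_def
    by (intro integral_cong_AE borel_measurable_times k assms)
      (use assms(3) in \<open>auto simp: AE_completion_iff\<close>)
qed

text \<open>With the factor \<open>pi\<close> the Gaussian has integral 1 and is its own transform
  under \<open>fker\<close>.\<close>

definition gauss :: "'a::euclidean_space \<Rightarrow> real" where
  "gauss x = exp (- (pi * (norm x)\<^sup>2))"

lemma gauss_measurable[measurable]: "gauss \<in> borel_measurable borel"
  unfolding gauss_def by measurable

lemma gauss_pos: "0 < gauss x"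
  by (simp add: gauss_def)

lemma gauss_prod: "gauss x = (\<Prod>b\<in>Basis. gauss (x \<bullet> b))"
  by (simp add: gauss_def exp_sum[symmetric] sum_negf sum_distrib_left[symmetric]
      norm_eq_sqrt_inner euclidean_inner[of x x] power2_eq_square sum_nonneg)

text \<open>After the substitution \<open>?c * x\<close> with \<open>?c = sqrt (2 * pi)\<close>,
  this is the characteristic function of the standard normal distribution, taken at
  \<open>- ?c * w\<close>.\<close>

lemma gauss_real: "integrable lborel (gauss :: real \<Rightarrow> real)"
  and fourier_gauss_real: "(\<integral>x. gauss x * fker (x * w) \<partial>lborel) = of_real (gauss (w::real))"
proof -
  let ?c = "sqrt (2 * pi)"
  have c: "?c \<noteq> 0" "?c > 0" by auto
  have g: "std_normal_density (0 + ?c * x) = gauss x / ?c" for x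
    by (simp add: std_normal_density_def gauss_def power_mult_distrib)
  have "integrable lborel (\<lambda>x. std_normal_density (0 + ?c * x))"
    by (rule lborel_integrable_real_affine) auto
  then show "integrable lborel (gauss :: real \<Rightarrow> real)"
    unfolding g using c integrable_mult_right[of ?c lborel "\<lambda>x. gauss x / ?c"] by simp
  have "complex_of_real (gauss w) = char std_normal_distribution (- ?c * w)"
    by (simp add: char_std_normal_distribution gauss_def power_mult_distrib)
  also have "\<dots> = (\<integral>x. std_normal_density x *\<^sub>R cis (- ?c * w * x) \<partial>lborel)"
    unfolding char_def by (subst integral_density) (auto simp: normal_density_nonneg cis_conv_exp)
  also have "\<dots> = ?c *\<^sub>R (\<integral>x. std_normal_density (0 + ?c * x) *\<^sub>R cis (- ?c * w * (0 + ?c * x)) \<partial>lborel)"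
    by (subst lborel_integral_real_affine[OF c(1), of _ 0]) simp
  also have "\<dots> = (\<integral>x. ?c *\<^sub>R (std_normal_density (0 + ?c * x) *\<^sub>R cis (- ?c * w * (0 + ?c * x))) \<partial>lborel)"
    by (rule integral_scaleR_right[symmetric])
  also have "\<dots> = (\<integral>x. gauss x * fker (x * w) \<partial>lborel)"
  proof (rule Bochner_Integration.integral_cong[OF refl])
    fix x
    have e: "- ?c * w * (0 + ?c * x) = - (2 * pi * (x * w))"
      by (simp add: algebra_simps)
    show "?c *\<^sub>R (std_normal_density (0 + ?c * x) *\<^sub>R cis (- ?c * w * (0 + ?c * x))) = gauss x * fker (x * w)"
      unfolding g fker_def e using c by (simp add: scaleR_conv_of_real)
  qed
  finally show "(\<integral>x. gauss x * fker (x * w) \<partial>lborel) = of_real (gauss w)" by simp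
qed

lemma integrable_gauss: "integrable lborel (gauss :: 'a::euclidean_space \<Rightarrow> real)"
proof (rule integrableI_nonneg)
  have "(\<integral>\<^sup>+x. gauss (x::'a) \<partial>lborel) = (\<integral>\<^sup>+x. (\<Prod>b\<in>(Basis::'a set). ennreal (gauss (x \<bullet> b))) \<partial>lborel)"
    by (subst gauss_prod) (simp add: prod_ennreal less_imp_le[OF gauss_pos])
  also have "\<dots> = (\<Prod>b\<in>(Basis::'a set). \<integral>\<^sup>+x. ennreal (gauss (x::real)) \<partial>lborel)"
    by (rule nn_integral_lborel_prod) auto
  also have "\<dots> < \<infinity>"
    using gauss_real by (auto simp: integrable_iff_bounded power_less_top_ennreal abs_of_pos[OF gauss_pos])
  finally show "(\<integral>\<^sup>+x. gauss (x::'a) \<partial>lborel) < \<infinity>" .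
qed (auto simp: less_imp_le[OF gauss_pos])

text \<open>Both the Gaussian and the character factor over the coordinates, so the product measure
  reduces the claim to dimension one.\<close>

lemma fourier_gauss:
  fixes w :: "'a::euclidean_space"
  shows "(\<integral>x. gauss x * fker (x \<bullet> w) \<partial>lborel) = of_real (gauss w)"
proof -
  interpret product_sigma_finite "\<lambda>_::'a. lborel :: real measure" ..
  have b: "(\<Sum>b\<in>Basis. f b *\<^sub>R b) \<bullet> c = f c" if "c \<in> Basis" for f and c :: 'a
    using that by simp
  have k: "fker (x \<bullet> w) = (\<Prod>b\<in>Basis. fker ((x \<bullet> b) * (w \<bullet> b)))" for x :: 'a
    by (simp add: fker_def euclidean_inner[of x w] sum_distrib_left cis_conv_exp exp_sum[symmetric] sum_distrib_right sum_negf)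
  have "(\<integral>x. gauss x * fker (x \<bullet> w) \<partial>lborel) =
      (\<integral>x. (\<Prod>b\<in>Basis. gauss (x \<bullet> b) * fker ((x \<bullet> b) * (w \<bullet> b))) \<partial>lborel)"
    by (subst gauss_prod, subst k) (simp add: prod.distrib)
  also have "\<dots> = (\<integral>x. (\<Prod>b\<in>Basis. gauss (x b) * fker (x b * (w \<bullet> b))) \<partial>(\<Pi>\<^sub>M b\<in>Basis. lborel))"
    by (subst lborel_eq, subst integral_distr) (auto simp: b intro!: Bochner_Integration.integral_cong prod.cong)
  also have "\<dots> = (\<Prod>b\<in>Basis. (\<integral>x. gauss x * fker (x * (w \<bullet> b)) \<partial>lborel))"
  proof (rule product_integral_prod)
    show "integrable lborel (\<lambda>x. gauss x * fker (x * (w \<bullet> b)))" for b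
      by (rule Bochner_Integration.integrable_bound[OF gauss_real]) (auto simp: norm_mult less_imp_le[OF gauss_pos])
  qed auto
  also have "\<dots> = of_real (gauss w)"
    unfolding fourier_gauss_real by (subst (2) gauss_prod) simp
  finally show ?thesis .
qed

lemma integral_gauss: "(\<integral>x. gauss (x::'a::euclidean_space) \<partial>lborel) = 1"
proof -
  have "complex_of_real (\<integral>x. gauss (x::'a) \<partial>lborel) = 1"
    using fourier_gauss[of "0::'a"] by (simp add: fker_def gauss_def)
  then show ?thesis by simp
qed

text \<open>As \<open>c\<close> grows, the Gaussian on the left flattens to 1 while the right side
  becomes an approximate identity; Plancherel compares these two limits.\<close>

lemma fourier_gauss_scaled:
  fixes w :: "'a::euclidean_space"
  assumes "0 < c"
  shows "(\<integral>x. gauss (x /\<^sub>R c) * fker (x \<bullet> w) \<partial>lborel) = of_real (c ^ DIM('a) * gauss (c *\<^sub>R w))"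
  by (subst integral_lborel_transform[OF lborel_scale[of c 0]])
     (use assms fourier_gauss[of "c *\<^sub>R w"] in \<open>auto simp: scaleR_conv_of_real\<close>)

lemma integrable_gauss_scaled:
  assumes "0 < c"
  shows "integrable lborel (\<lambda>x::'a::euclidean_space. gauss (x /\<^sub>R c))"
  using integrable_lborel_transform[OF lborel_scale[of c 0], of "\<lambda>x::'a. gauss (x /\<^sub>R c)"] integrable_gauss assms
  by simp

section \<open>Plancherel for bounded continuous integrable functions\<close>

lemma cnj_measurable[measurable]: "cnj \<in> borel_measurable borel"
  by (intro borel_measurable_continuous_onI continuous_intros)

lemma integrable_kernel:
  fixes f :: "'a::euclidean_space \<Rightarrow> complex" and g :: "'b::euclidean_space \<Rightarrow> complex"
  assumes f: "integrable lborel f" and g: "integrable lborel g"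
    and [measurable]: "(\<lambda>(x, y). k x y) \<in> borel_measurable (lborel \<Otimes>\<^sub>M lborel)"
    and k: "\<And>x y. cmod (k x y) \<le> B"
  shows "integrable (lborel \<Otimes>\<^sub>M lborel) (\<lambda>(x, y). f x * g y * k x y)"
proof -
  have [measurable]: "f \<in> borel_measurable borel" "g \<in> borel_measurable borel"
    using f g by auto
  have "integrable (lborel \<Otimes>\<^sub>M lborel) (\<lambda>(x, y). f x * g y)"
    by (rule lborel_pair.Fubini_integrable)
      (use f g in \<open>auto simp: norm_mult\<close>)
  then have "integrable (lborel \<Otimes>\<^sub>M lborel) (\<lambda>p. B *\<^sub>R (case p of (x, y) \<Rightarrow> f x * g y))"
    by simp
  then show ?thesis
  proof (rule Bochner_Integration.integrable_bound, goal_cases)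
    case 2
    \<comment> \<open>Of the two remaining goals, measurability and domination, this is the
      domination; any single kernel value shows that \<open>B\<close> is nonnegative.\<close>
    have "0 \<le> B" using k[of undefined undefined] norm_ge_zero order_trans by blast
    then have "cmod (f x) * cmod (g y) * cmod (k x y) \<le> B * (cmod (f x) * cmod (g y))" for x y
      using mult_left_mono[OF k[of x y], of "cmod (f x) * cmod (g y)"] by (simp add: mult_ac)
    with \<open>0 \<le> B\<close> show ?case by (auto simp: norm_mult)
  qed measurable
qed

lemma Fubini_kernel:
  fixes f :: "'a::euclidean_space \<Rightarrow> complex" and g :: "'b::euclidean_space \<Rightarrow> complex"
  assumes "integrable lborel f" "integrable lborel g"
    and "(\<lambda>(x, y). k x y) \<in> borel_measurable (lborel \<Otimes>\<^sub>M lborel)"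
    and "\<And>x y. cmod (k x y) \<le> B"
  shows "(\<integral>x. f x * (\<integral>y. g y * k x y \<partial>lborel) \<partial>lborel) = (\<integral>y. g y * (\<integral>x. f x * k x y \<partial>lborel) \<partial>lborel)"
proof -
  have "(\<integral>x. f x * (\<integral>y. g y * k x y \<partial>lborel) \<partial>lborel) = (\<integral>x. \<integral>y. f x * g y * k x y \<partial>lborel \<partial>lborel)"
    \<comment> \<open>Read backwards, \<open>integral_mult_right_zero\<close> moves a constant
      factor under the integral without an integrability condition.\<close>
    by (simp add: integral_mult_right_zero[symmetric] mult.assoc del: integral_mult_right_zero)
  also have "\<dots> = (\<integral>y. \<integral>x. f x * g y * k x y \<partial>lborel \<partial>lborel)"
    using integrable_kernel[OF assms] by (intro lborel_pair.Fubini_integral[symmetric]) simp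
  also have "\<dots> = (\<integral>y. g y * (\<integral>x. f x * k x y \<partial>lborel) \<partial>lborel)"
    by (simp add: integral_mult_right_zero[symmetric] mult_ac del: integral_mult_right_zero)
  finally show ?thesis .
qed

text \<open>Continuity makes Gaussian averages converge at every point, boundedness provides the
  dominating functions, and integrability makes the transform an integral.\<close>

definition tame :: "('a::euclidean_space \<Rightarrow> complex) \<Rightarrow> bool" where
  "tame u \<longleftrightarrow> continuous_on UNIV u \<and> bounded (range u) \<and> integrable lborel u"

lemma tame_measurable: "tame u \<Longrightarrow> u \<in> borel_measurable borel"
  by (auto simp: tame_def)

lemma tame_bound:
  assumes "tame u" obtains M where "0 < M" "\<And>x. cmod (u x) \<le> M"
  using assms bounded_pos[of "range u"] unfolding tame_def by auto

lemma tame_square_integrable: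
  assumes "tame u" shows "integrable lborel (\<lambda>x. (cmod (u x))\<^sup>2)"
proof -
  note [measurable] = tame_measurable[OF assms]
  obtain M where M: "0 < M" "\<And>x. cmod (u x) \<le> M" using tame_bound[OF assms] by blast
  have "integrable lborel (\<lambda>x. M * cmod (u x))" using assms by (simp add: tame_def)
  then show ?thesis
    by (rule Bochner_Integration.integrable_bound)
      (use M in \<open>auto simp: power2_eq_square abs_mult intro!: mult_right_mono\<close>)
qed

lemma fourier_L1_bound:
  assumes "integrable lborel f"
  shows "cmod (fourier_L1 f \<omega>) \<le> (\<integral>x. cmod (f x) \<partial>lborel)"
proof -
  have "f \<in> borel_measurable borel" using assms by auto
  then show ?thesis
    using integral_norm_bound[of lborel "\<lambda>x. f x * fker (\<omega> \<bullet> x)"]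
    by (simp add: fourier_L1_lborel norm_mult)
qed

lemma fourier_L1_measurable:
  assumes [measurable]: "f \<in> borel_measurable borel"
  shows "fourier_L1 f \<in> borel_measurable borel"
  by (subst fourier_L1_lborel[OF assms, abs_def]) measurable

text \<open>The Gaussian summability factor makes the triple integral over \<open>\<omega>\<close>, \<open>x\<close>, \<open>y\<close> absolutely
  convergent; \<open>w\<close> is \<open>c (x - y)\<close>.\<close>

lemma fourier_square_gauss:
  fixes u :: "'a::euclidean_space \<Rightarrow> complex"
  assumes u: "integrable lborel u" and c: "0 < c"
  shows "of_real (\<integral>\<omega>. (cmod (fourier_L1 u \<omega>))\<^sup>2 * gauss (\<omega> /\<^sub>R c) \<partial>lborel) =
    (\<integral>x. u x * cnj (\<integral>w. u (x - w /\<^sub>R c) * gauss w \<partial>lborel) \<partial>lborel)"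
proof -
  have um[measurable]: "u \<in> borel_measurable borel" using u by auto
  note [measurable] = fourier_L1_measurable[OF um]
  let ?B = "\<integral>x. cmod (u x) \<partial>lborel"
  have G: "integrable lborel (\<lambda>\<omega>. complex_of_real (gauss (\<omega> /\<^sub>R c)))"
    using integrable_gauss_scaled[OF c] by (rule integrable_of_real)
  \<comment> \<open>Fourier inversion damped by the Gaussian: the result is the Gaussian average of
    \<open>u\<close> around \<open>x\<close> at scale \<open>1 / c\<close>.\<close>
  have inner: "(\<integral>\<omega>. gauss (\<omega> /\<^sub>R c) * (fourier_L1 u \<omega> * fker (- (\<omega> \<bullet> x))) \<partial>lborel) =
      (\<integral>w. u (x - w /\<^sub>R c) * gauss w \<partial>lborel)" for x
  proof -
    have "(\<integral>\<omega>. gauss (\<omega> /\<^sub>R c) * (fourier_L1 u \<omega> * fker (- (\<omega> \<bullet> x))) \<partial>lborel) =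
      (\<integral>\<omega>. gauss (\<omega> /\<^sub>R c) * (\<integral>y. u y * fker (\<omega> \<bullet> (y - x)) \<partial>lborel) \<partial>lborel)"
      by (simp add: fourier_L1_lborel integral_mult_left_zero[symmetric] inner_diff_right
          fker_add[symmetric] mult.assoc del: integral_mult_left_zero)
    also have "\<dots> = (\<integral>y. u y * (\<integral>\<omega>. gauss (\<omega> /\<^sub>R c) * fker (\<omega> \<bullet> (y - x)) \<partial>lborel) \<partial>lborel)"
      by (rule Fubini_kernel[OF G u, of _ 1]) simp_all
    also have "\<dots> = (\<integral>y. u y * of_real (c ^ DIM('a) * gauss (c *\<^sub>R (y - x))) \<partial>lborel)"
      by (simp add: fourier_gauss_scaled[OF c])
    \<comment> \<open>Substitution \<open>y = x - w / c\<close>; its Jacobian cancels the factor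
      \<open>c ^ DIM('a)\<close> of the transformed Gaussian.\<close>
    also have "\<dots> = (1 / c) ^ DIM('a) *\<^sub>R (\<integral>w. u (x + (- 1 / c) *\<^sub>R w) * of_real (c ^ DIM('a) * gauss w) \<partial>lborel)"
      by (subst integral_lborel_transform[OF lborel_scale[of "- 1 / c" x]])
        (use c in \<open>auto simp: gauss_def\<close>)
    also have "\<dots> = (\<integral>w. u (x - w /\<^sub>R c) * gauss w \<partial>lborel)"
      unfolding integral_scaleR_right[symmetric]
      by (rule Bochner_Integration.integral_cong)
        (use c in \<open>auto simp: scaleR_conv_of_real power_one_over field_simps\<close>)
    finally show ?thesis .
  qed
  have "of_real (\<integral>\<omega>. (cmod (fourier_L1 u \<omega>))\<^sup>2 * gauss (\<omega> /\<^sub>R c) \<partial>lborel) =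
      (\<integral>\<omega>. complex_of_real ((cmod (fourier_L1 u \<omega>))\<^sup>2 * gauss (\<omega> /\<^sub>R c)) \<partial>lborel)"
    by (rule integral_complex_of_real[symmetric])
  \<comment> \<open>Only one of the two factors of the squared modulus is opened into an integral
    over \<open>x\<close>; the conjugate factor stays in the kernel, where it is bounded by the L1
    norm of \<open>u\<close>.\<close>
  also have "\<dots> = (\<integral>\<omega>. gauss (\<omega> /\<^sub>R c) * (\<integral>x. u x * (fker (\<omega> \<bullet> x) * cnj (fourier_L1 u \<omega>)) \<partial>lborel) \<partial>lborel)"
  proof (intro Bochner_Integration.integral_cong refl)
    fix \<omega>
    have "(\<integral>x. u x * (fker (\<omega> \<bullet> x) * cnj (fourier_L1 u \<omega>)) \<partial>lborel) = fourier_L1 u \<omega> * cnj (fourier_L1 u \<omega>)"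
      unfolding mult.assoc[symmetric] integral_mult_left_zero fourier_L1_lborel[OF um] ..
    then show "complex_of_real ((cmod (fourier_L1 u \<omega>))\<^sup>2 * gauss (\<omega> /\<^sub>R c)) =
        gauss (\<omega> /\<^sub>R c) * (\<integral>x. u x * (fker (\<omega> \<bullet> x) * cnj (fourier_L1 u \<omega>)) \<partial>lborel)"
      by (simp only: of_real_mult complex_norm_square mult.commute)
  qed
  also have "\<dots> = (\<integral>x. u x * (\<integral>\<omega>. gauss (\<omega> /\<^sub>R c) * (fker (\<omega> \<bullet> x) * cnj (fourier_L1 u \<omega>)) \<partial>lborel) \<partial>lborel)"
    by (rule Fubini_kernel[OF G u, of _ ?B]) (measurable, simp add: norm_mult fourier_L1_bound[OF u])
  also have "\<dots> = (\<integral>x. u x * cnj (\<integral>w. u (x - w /\<^sub>R c) * gauss w \<partial>lborel) \<partial>lborel)"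
  proof (intro Bochner_Integration.integral_cong refl)
    fix x
    have "cnj (\<integral>\<omega>. gauss (\<omega> /\<^sub>R c) * (fourier_L1 u \<omega> * fker (- (\<omega> \<bullet> x))) \<partial>lborel) =
        (\<integral>\<omega>. cnj (gauss (\<omega> /\<^sub>R c) * (fourier_L1 u \<omega> * fker (- (\<omega> \<bullet> x)))) \<partial>lborel)"
      by (rule Bochner_Integration.integral_cnj[symmetric])
    also have "\<dots> = (\<integral>\<omega>. gauss (\<omega> /\<^sub>R c) * (fker (\<omega> \<bullet> x) * cnj (fourier_L1 u \<omega>)) \<partial>lborel)"
      by (simp add: fker_minus mult_ac)
    finally show "u x * (\<integral>\<omega>. gauss (\<omega> /\<^sub>R c) * (fker (\<omega> \<bullet> x) * cnj (fourier_L1 u \<omega>)) \<partial>lborel) =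
        u x * cnj (\<integral>w. u (x - w /\<^sub>R c) * gauss w \<partial>lborel)"
      unfolding inner by simp
  qed
  finally show ?thesis .
qed

text \<open>The Gaussian has mass 1, and continuity at \<open>x\<close> gives pointwise convergence
  of the integrand under the dominating function \<open>M * gauss w\<close>.\<close>

lemma gauss_average_tendsto:
  fixes u :: "'a::euclidean_space \<Rightarrow> complex"
  assumes u: "tame u"
  shows "(\<lambda>n. \<integral>w. u (x - w /\<^sub>R real (Suc n)) * gauss w \<partial>lborel) \<longlonglongrightarrow> u x"
proof -
  note [measurable] = tame_measurable[OF u]
  obtain M where M: "0 < M" "\<And>x. cmod (u x) \<le> M" using tame_bound[OF u] by blast
  have lim: "(\<lambda>n. u (x - w /\<^sub>R real (Suc n))) \<longlonglongrightarrow> u x" for w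
  proof -
    have "(\<lambda>n. x - w /\<^sub>R real (Suc n)) \<longlonglongrightarrow> x - 0 *\<^sub>R w"
      by (intro tendsto_intros LIMSEQ_inverse_real_of_nat)
    moreover have "isCont u x" using u by (simp add: tame_def continuous_on_eq_continuous_at)
    ultimately show ?thesis by (intro isCont_tendsto_compose[of x u]) auto
  qed
  have "(\<lambda>n. \<integral>w. u (x - w /\<^sub>R real (Suc n)) * gauss w \<partial>lborel) \<longlonglongrightarrow> (\<integral>w. u x * complex_of_real (gauss (w::'a)) \<partial>lborel)"
  proof (rule integral_dominated_convergence)
    show "integrable lborel (\<lambda>w::'a. M * gauss w)" using integrable_gauss[where 'a='a] by simp
    show "AE w in lborel. (\<lambda>n. u (x - w /\<^sub>R real (Suc n)) * gauss w) \<longlonglongrightarrow> u x * complex_of_real (gauss w)"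
      by (intro always_eventually allI tendsto_intros lim)
    show "AE w in lborel. cmod (u (x - w /\<^sub>R real (Suc n)) * gauss w) \<le> M * gauss w" for n
      using M by (auto simp: norm_mult less_imp_le[OF gauss_pos] intro!: mult_right_mono)
  qed measurable
  also have "(\<integral>w. u x * complex_of_real (gauss (w::'a)) \<partial>lborel) = u x"
    by (simp add: integral_gauss)
  finally show ?thesis .
qed

text \<open>The limit of \<open>fourier_square_gauss\<close> along \<open>c = Suc n\<close>:
  dominated convergence in space, monotone convergence in frequency. Monotonicity is what makes the
  frequency side work, since the squared transform is not yet known to be integrable.\<close>

lemma Plancherel_tame:
  fixes u :: "'a::euclidean_space \<Rightarrow> complex"
  assumes u: "tame u"
  shows "(\<integral>\<^sup>+\<omega>. (cmod (fourier_L1 u \<omega>))\<^sup>2 \<partial>lborel) = (\<integral>\<^sup>+x. (cmod (u x))\<^sup>2 \<partial>lborel)"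
proof -
  note um[measurable] = tame_measurable[OF u]
  note [measurable] = fourier_L1_measurable[OF um]
  have ui: "integrable lborel u" using u by (simp add: tame_def)
  obtain M where M: "0 < M" "\<And>x. cmod (u x) \<le> M" using tame_bound[OF u] by blast
  let ?K = "\<lambda>n x. \<integral>w. u (x - w /\<^sub>R real (Suc n)) * gauss w \<partial>lborel"
  let ?g = "\<lambda>n \<omega>::'a. gauss (\<omega> /\<^sub>R real (Suc n))"
  let ?I = "\<lambda>n. \<integral>\<omega>. (cmod (fourier_L1 u \<omega>))\<^sup>2 * ?g n \<omega> \<partial>lborel"
  have K: "cmod (?K n x) \<le> M" for n x
  proof -
    have "cmod (?K n x) \<le> (\<integral>w. M * gauss (w::'a) \<partial>lborel)"
    proof (rule Bochner_Integration.integral_norm_bound_integral)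
      show gi: "integrable lborel (\<lambda>w::'a. M * gauss w)" using integrable_gauss[where 'a='a] by simp
      show bd: "cmod (u (x - w /\<^sub>R real (Suc n)) * gauss w) \<le> M * gauss w" for w
        using M by (auto simp: norm_mult less_imp_le[OF gauss_pos] intro!: mult_right_mono)
      show "integrable lborel (\<lambda>w. u (x - w /\<^sub>R real (Suc n)) * gauss w)"
        by (rule Bochner_Integration.integrable_bound[OF gi]) (use bd order.trans[OF _ abs_ge_self] in auto)
    qed
    then show ?thesis by (simp add: integral_gauss)
  qed
  have "(\<lambda>n. \<integral>x. u x * cnj (?K n x) \<partial>lborel) \<longlonglongrightarrow> (\<integral>x. u x * cnj (u x) \<partial>lborel)"
  proof (rule integral_dominated_convergence)
    show "integrable lborel (\<lambda>x. M * cmod (u x))" using ui by simp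
    show "AE x in lborel. (\<lambda>n. u x * cnj (?K n x)) \<longlonglongrightarrow> u x * cnj (u x)"
      by (intro always_eventually allI tendsto_intros tendsto_cnj gauss_average_tendsto[OF u])
    show "AE x in lborel. cmod (u x * cnj (?K n x)) \<le> M * cmod (u x)" for n
      unfolding norm_mult complex_mod_cnj mult.commute[of M] using K[of _ n] by (auto intro!: mult_left_mono)
  qed measurable
  then have "(\<lambda>n. complex_of_real (?I n)) \<longlonglongrightarrow> of_real (\<integral>x. (cmod (u x))\<^sup>2 \<partial>lborel)"
    unfolding fourier_square_gauss[OF ui, of "real (Suc _)", OF of_nat_0_less_iff[THEN iffD2, OF zero_less_Suc]]
    by (simp only: complex_norm_square[symmetric] integral_complex_of_real)
  then have "?I \<longlonglongrightarrow> (\<integral>x. (cmod (u x))\<^sup>2 \<partial>lborel)"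
    by (simp only: tendsto_of_real_iff)
  \<comment> \<open>The passage to \<open>ennreal\<close> prepares monotone convergence on the
    frequency side, whose limit could a priori be infinite.\<close>
  then have "(\<lambda>n. ennreal (?I n)) \<longlonglongrightarrow> ennreal (\<integral>x. (cmod (u x))\<^sup>2 \<partial>lborel)"
    by (rule tendsto_ennrealI)
  also have "(\<lambda>n. ennreal (?I n)) = (\<lambda>n. \<integral>\<^sup>+\<omega>. (cmod (fourier_L1 u \<omega>))\<^sup>2 * ?g n \<omega> \<partial>lborel)"
  proof
    fix n
    let ?B = "\<integral>x. cmod (u x) \<partial>lborel"
    have "integrable lborel (\<lambda>\<omega>. ?B\<^sup>2 * ?g n \<omega>)"
      using integrable_gauss_scaled[of "real (Suc n)", where 'a='a] by simp
    then have "integrable lborel (\<lambda>\<omega>. (cmod (fourier_L1 u \<omega>))\<^sup>2 * ?g n \<omega>)"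
      by (rule Bochner_Integration.integrable_bound)
        (auto simp: abs_mult less_imp_le[OF gauss_pos] intro!: mult_right_mono power_mono fourier_L1_bound[OF ui])
    then show "ennreal (?I n) = (\<integral>\<^sup>+\<omega>. (cmod (fourier_L1 u \<omega>))\<^sup>2 * ?g n \<omega> \<partial>lborel)"
      by (intro nn_integral_eq_integral[symmetric]) (auto simp: less_imp_le[OF gauss_pos])
  qed
  finally have 1: "(\<lambda>n. \<integral>\<^sup>+\<omega>. (cmod (fourier_L1 u \<omega>))\<^sup>2 * ?g n \<omega> \<partial>lborel) \<longlonglongrightarrow> ennreal (\<integral>x. (cmod (u x))\<^sup>2 \<partial>lborel)" .
  have 2: "(\<lambda>n. \<integral>\<^sup>+\<omega>. (cmod (fourier_L1 u \<omega>))\<^sup>2 * ?g n \<omega> \<partial>lborel) \<longlonglongrightarrow> (\<integral>\<^sup>+\<omega>. (cmod (fourier_L1 u \<omega>))\<^sup>2 \<partial>lborel)"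
  proof (rule nn_integral_LIMSEQ)
    \<comment> \<open>The Gaussian decreases in the norm, and the argument shrinks as the index
      grows.\<close>
    have "gauss (\<omega> /\<^sub>R real (Suc m)) \<le> gauss (\<omega> /\<^sub>R real (Suc n))" if "m \<le> n" for m n and \<omega> :: 'a
      using that by (auto simp: gauss_def intro!: mult_right_mono power_mono le_imp_inverse_le)
    then show "incseq (\<lambda>n \<omega>. ennreal ((cmod (fourier_L1 u \<omega>))\<^sup>2 * ?g n \<omega>))"
      by (auto simp: incseq_def le_fun_def intro!: ennreal_leI mult_left_mono)
    fix \<omega> :: 'a
    have "(\<lambda>n. gauss (\<omega> /\<^sub>R real (Suc n))) \<longlonglongrightarrow> exp (- (pi * (norm (0 *\<^sub>R \<omega>))\<^sup>2))"
      unfolding gauss_def by (intro tendsto_intros LIMSEQ_inverse_real_of_nat)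
    then have "(\<lambda>n. (cmod (fourier_L1 u \<omega>))\<^sup>2 * ?g n \<omega>) \<longlonglongrightarrow> (cmod (fourier_L1 u \<omega>))\<^sup>2 * 1"
      by (intro tendsto_intros) simp
    then show "(\<lambda>n. ennreal ((cmod (fourier_L1 u \<omega>))\<^sup>2 * ?g n \<omega>)) \<longlonglongrightarrow> ennreal ((cmod (fourier_L1 u \<omega>))\<^sup>2)"
      by (intro tendsto_ennrealI) simp
  qed measurable
  show ?thesis
    using LIMSEQ_unique[OF 1 2] nn_integral_eq_integral[OF tame_square_integrable[OF u]] by simp
qed

text \<open>This \<open>u\<close> is the inner product of \<open>f\<close> with the translate of
  \<open>h\<close> by \<open>t\<close>, written in the variable \<open>y = x - t\<close>. The
  function \<open>M * cmod (h y)\<close> dominates the integrand for all \<open>t\<close> at once,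
  which yields both the bound and continuity; integrability and the product formula come from
  Fubini.\<close>

lemma tame_correlation:
  fixes f h :: "'a::euclidean_space \<Rightarrow> complex"
  assumes f: "tame f" and h: "integrable lborel h"
  defines "u \<equiv> \<lambda>t. \<integral>y. cnj (h y) * f (t + y) \<partial>lborel"
  shows "tame u" "fourier_L1 u \<omega> = fourier_L1 f \<omega> * cnj (fourier_L1 h \<omega>)"
proof -
  note fm[measurable] = tame_measurable[OF f]
  have fi: "integrable lborel f" using f by (simp add: tame_def)
  have hm[measurable]: "h \<in> borel_measurable borel" using h by auto
  obtain M where M: "0 < M" "\<And>x. cmod (f x) \<le> M" using tame_bound[OF f] by blast
  have hM: "integrable lborel (\<lambda>y. M * cmod (h y))" using h by simp
  have shift: "lborel = density (distr lborel borel ((+) y)) (\<lambda>_. ennreal 1)" for y :: 'a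
    by (simp add: lborel_distr_plus density_1)
  have fs: "integrable lborel (\<lambda>t. f (y + t))" for y
    using integrable_lborel_transform[OF shift, of y f] fi by simp
  \<comment> \<open>By translation invariance the iterated integral of the modulus is the product of
    the two L1 norms.\<close>
  have int: "integrable (lborel \<Otimes>\<^sub>M lborel) (\<lambda>(y, t). cnj (h y) * f (t + y))"
  proof (rule lborel_pair.Fubini_integrable)
    have "(\<integral>t. cmod (f (t + y)) \<partial>lborel) = (\<integral>t. cmod (f t) \<partial>lborel)" for y
      using integral_lborel_transform[OF shift, of y "\<lambda>t. cmod (f t)"] by (simp add: add.commute)
    then show "integrable lborel (\<lambda>x. \<integral>y. cmod (case (x, y) of (y, t) \<Rightarrow> cnj (h y) * f (t + y)) \<partial>lborel)"
      using h by (simp add: norm_mult)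
    show "AE y in lborel. integrable lborel (\<lambda>t. case (y, t) of (y, t) \<Rightarrow> cnj (h y) * f (t + y))"
      using fs by (simp add: add.commute)
  qed measurable
  have ui: "integrable lborel u"
    unfolding u_def
    using lborel_pair.integrable_fst'[OF lborel_pair.integrable_product_swap[OF int]] by simp
  have uB: "cmod (u t) \<le> (\<integral>y. M * cmod (h y) \<partial>lborel)" for t
    unfolding u_def
  proof (rule Bochner_Integration.integral_norm_bound_integral[OF _ hM])
    show bd: "cmod (cnj (h y) * f (t + y)) \<le> M * cmod (h y)" for y
      using M by (auto simp: norm_mult mult.commute[of M] intro!: mult_left_mono)
    show "integrable lborel (\<lambda>y. cnj (h y) * f (t + y))"
      by (rule Bochner_Integration.integrable_bound[OF hM]) (use bd order.trans[OF _ abs_ge_self] in auto)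
  qed
  have "isCont u t" for t
    unfolding continuous_at_sequentially
  proof (intro allI impI)
    fix X assume X: "X \<longlonglongrightarrow> t"
    have "(\<lambda>n. f (X n + y)) \<longlonglongrightarrow> f (t + y)" for y
    proof -
      have "isCont f (t + y)" using f by (simp add: tame_def continuous_on_eq_continuous_at)
      moreover have "(\<lambda>n. X n + y) \<longlonglongrightarrow> t + y" by (intro tendsto_intros X)
      ultimately show ?thesis by (rule isCont_tendsto_compose)
    qed
    then show "(u \<circ> X) \<longlonglongrightarrow> u t"
      unfolding u_def o_def
      by (intro integral_dominated_convergence[OF _ _ hM])
        (use M in \<open>auto simp: norm_mult mult.commute[of M] intro!: tendsto_intros mult_left_mono\<close>)
  qed
  then show "tame u"
    unfolding tame_def using ui uB by (auto simp: bounded_iff continuous_on_eq_continuous_at)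
  have [measurable]: "u \<in> borel_measurable borel" using ui by auto
  have int2: "integrable (lborel \<Otimes>\<^sub>M lborel) (\<lambda>(y, t). cnj (h y) * f (t + y) * fker (\<omega> \<bullet> t))"
    by (rule Bochner_Integration.integrable_bound[OF int]) (auto simp: norm_mult)
  have "fourier_L1 u \<omega> = (\<integral>t. \<integral>y. cnj (h y) * f (t + y) * fker (\<omega> \<bullet> t) \<partial>lborel \<partial>lborel)"
    by (subst fourier_L1_lborel) (simp_all add: u_def)
  also have "\<dots> = (\<integral>y. \<integral>t. cnj (h y) * f (t + y) * fker (\<omega> \<bullet> t) \<partial>lborel \<partial>lborel)"
    using int2 by (intro lborel_pair.Fubini_integral) simp
  \<comment> \<open>Translating \<open>t\<close> by \<open>y\<close> turns the inner integral into
    the transform of \<open>f\<close> times the character at \<open>-y\<close>, which completes the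
    conjugate transform of \<open>h\<close>.\<close>
  also have "\<dots> = (\<integral>y. cnj (h y) * (fourier_L1 f \<omega> * fker (- (\<omega> \<bullet> y))) \<partial>lborel)"
  proof (intro Bochner_Integration.integral_cong refl)
    fix y
    have "fourier_L1 f \<omega> = (\<integral>t. f (y + t) * fker (\<omega> \<bullet> (y + t)) \<partial>lborel)"
      using integral_lborel_transform[OF shift, of y "\<lambda>t. f t * fker (\<omega> \<bullet> t)"]
      by (simp add: fourier_L1_lborel)
    then have "fourier_L1 f \<omega> * fker (- (\<omega> \<bullet> y)) = (\<integral>t. f (t + y) * fker (\<omega> \<bullet> t) \<partial>lborel)"
      by (simp add: integral_mult_left_zero[symmetric] mult.assoc fker_add[symmetric] inner_add_right
          add.commute del: integral_mult_left_zero)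
    then show "(\<integral>t. cnj (h y) * f (t + y) * fker (\<omega> \<bullet> t) \<partial>lborel) = cnj (h y) * (fourier_L1 f \<omega> * fker (- (\<omega> \<bullet> y)))"
      by (simp add: mult.assoc)
  qed
  also have "\<dots> = (\<integral>y. fourier_L1 f \<omega> * cnj (h y * fker (\<omega> \<bullet> y)) \<partial>lborel)"
    by (simp add: fker_minus mult_ac)
  also have "\<dots> = fourier_L1 f \<omega> * cnj (fourier_L1 h \<omega>)"
    by (simp only: fourier_L1_lborel[OF hm] Bochner_Integration.integral_cnj integral_mult_right_zero)
  finally show "fourier_L1 u \<omega> = fourier_L1 f \<omega> * cnj (fourier_L1 h \<omega>)" .
qed

text \<open>Plancherel is applied to the correlation as a function of \<open>t\<close>, which is
  tame, so \<open>h\<close> itself need only be integrable.\<close>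

lemma correlation_Plancherel:
  fixes f h :: "'a::euclidean_space \<Rightarrow> complex"
  assumes f: "tame f" and h: "integrable lborel h"
  shows "(\<integral>\<^sup>+t. (cmod (\<integral>x. f x * cnj (h (x - t)) \<partial>lborel))\<^sup>2 \<partial>lborel) =
    (\<integral>\<^sup>+\<omega>. ennreal ((cmod (fourier_L1 f \<omega>))\<^sup>2) * ennreal ((cmod (fourier_L1 h \<omega>))\<^sup>2) \<partial>lborel)"
proof -
  have [measurable]: "f \<in> borel_measurable borel" "h \<in> borel_measurable borel"
    using tame_measurable[OF f] h by auto
  have shift: "lborel = density (distr lborel borel ((+) y)) (\<lambda>_. ennreal 1)" for y :: 'a
    by (simp add: lborel_distr_plus density_1)
  have "(\<integral>x. f x * cnj (h (x - t)) \<partial>lborel) = (\<integral>y. cnj (h y) * f (t + y) \<partial>lborel)" for t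
    using integral_lborel_transform[OF shift, of t "\<lambda>x. f x * cnj (h (x - t))"]
    by (simp add: mult.commute[of _ "f _"])
  then show ?thesis
    using Plancherel_tame[OF tame_correlation(1)[OF f h]]
    by (simp add: tame_correlation(2)[OF f h] norm_mult power_mult_distrib ennreal_mult)
qed

section \<open>Density in L2 and extension of isometries\<close>

lemma tame_add: "tame f \<Longrightarrow> tame g \<Longrightarrow> tame (\<lambda>x. f x + g x)"
  unfolding tame_def by (auto intro: continuous_intros bounded_plus_comp)

text \<open>Regularity sandwiches \<open>A\<close> between a closed \<open>K\<close> and an open
  \<open>U\<close> with small difference. A Urysohn function equal to \<open>c\<close> on
  \<open>K\<close> and 0 off \<open>U\<close> can differ from the target only on
  \<open>U - K\<close>, and there by at most \<open>cmod c\<close>.\<close>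

lemma tame_indicator_approx:
  fixes c :: complex and A :: "'a::euclidean_space set"
  assumes A: "A \<in> sets borel" "emeasure lborel A < \<infinity>" and e: "0 < e"
  shows "\<exists>g. tame g \<and> (\<integral>\<^sup>+x. cmod (indicator A x *\<^sub>R c - g x) \<partial>lborel) < ennreal e"
proof -
  \<comment> \<open>The final error is at most \<open>cmod c * (d + d)\<close>; the added 1 keeps
    the quotient meaningful for \<open>c = 0\<close> and the inequality strict.\<close>
  define d where "d = e / (2 * (cmod c + 1))"
  have d: "0 < d" using e by (auto simp: d_def add_nonneg_pos)
  have AL: "A \<in> sets lebesgue" using A by simp
  obtain U where U: "open U" "A \<subseteq> U" "U - A \<in> lmeasurable" "emeasure lebesgue (U - A) < ennreal d"
    using sets_lebesgue_outer_open[OF AL d] by blast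
  obtain K where K: "closed K" "K \<subseteq> A" "A - K \<in> lmeasurable" "emeasure lebesgue (A - K) < ennreal d"
    using sets_lebesgue_inner_closed[OF AL d] by blast
  have m[measurable]: "U \<in> sets borel" "K \<in> sets borel" "A \<in> sets borel" using U K A by auto
  have "emeasure lborel (U - A) < ennreal d" "emeasure lborel (A - K) < ennreal d"
    using U K m by auto
  have UK: "emeasure lborel (U - K) < ennreal (d + d)"
  proof -
    have "emeasure lborel (U - K) \<le> emeasure lborel ((U - A) \<union> (A - K))"
      by (intro emeasure_mono) auto
    also have "\<dots> \<le> emeasure lborel (U - A) + emeasure lborel (A - K)"
      by (intro emeasure_subadditive) auto
    also have "\<dots> < ennreal d + ennreal d"
      by (intro add_strict_mono) fact+
    finally show ?thesis using d by (simp add: ennreal_plus[symmetric] del: ennreal_plus)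
  qed
  \<comment> \<open>Finite measure of \<open>U\<close> makes its indicator an integrable majorant
    for \<open>g\<close>.\<close>
  have Ufin: "emeasure lborel U < \<infinity>"
  proof -
    have "emeasure lborel U \<le> emeasure lborel (A \<union> (U - A))"
      using U(2) by (intro emeasure_mono) auto
    also have "\<dots> \<le> emeasure lborel A + emeasure lborel (U - A)"
      by (intro emeasure_subadditive) auto
    also have "\<dots> < \<infinity>"
      using A \<open>emeasure lborel (U - A) < ennreal d\<close> by (auto simp: less_top[symmetric] top_unique)
    finally show ?thesis .
  qed
  \<comment> \<open>Values on the segment from 0 to \<open>c\<close> bound both
    \<open>cmod (g x)\<close> and \<open>cmod (c - g x)\<close> by \<open>cmod c\<close>.\<close>
  obtain g :: "'a \<Rightarrow> complex" where g: "continuous_on UNIV g" "\<And>x. g x \<in> closed_segment 0 c"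
    "\<And>x. x \<in> - U \<Longrightarrow> g x = 0" "\<And>x. x \<in> K \<Longrightarrow> g x = c"
    by (rule Urysohn[of "- U" K 0 c]) (use U K in auto)
  have gc: "cmod (g x) \<le> cmod c" for x
    using segment_bound(1)[OF g(2)[of x]] by simp
  have gm[measurable]: "g \<in> borel_measurable borel" using g(1) by (rule borel_measurable_continuous_onI)
  have "integrable lborel (\<lambda>x. indicator U x *\<^sub>R c)"
    using Ufin by (intro integrable_indicator_iff[THEN iffD2] integrable_scaleR_left) auto
  then have "integrable lborel g"
    by (rule Bochner_Integration.integrable_bound) (use gc g(3) in \<open>auto simp: indicator_def\<close>)
  then have "tame g" unfolding tame_def using g(1) gc by (auto simp: bounded_iff)
  have gs: "cmod (c - g x) \<le> cmod c" for x
    using segment_bound(2)[OF g(2)[of x]] by (simp add: norm_minus_commute)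
  have "cmod (indicator A x *\<^sub>R c - g x) \<le> cmod c * indicator (U - K) x" for x
    using gc[of x] gs[of x] g(3,4)[of x] U(2) K(2) by (auto simp: indicator_def)
  then have "(\<integral>\<^sup>+x. cmod (indicator A x *\<^sub>R c - g x) \<partial>lborel) \<le> (\<integral>\<^sup>+x. ennreal (cmod c) * indicator (U - K) x \<partial>lborel)"
    by (intro nn_integral_mono) (simp add: ennreal_mult'[symmetric] ennreal_leI flip: ennreal_indicator)
  also have "\<dots> = ennreal (cmod c) * emeasure lborel (U - K)"
    by (intro nn_integral_cmult_indicator) auto
  also have "\<dots> \<le> ennreal (cmod c) * ennreal (d + d)"
    using UK by (intro mult_left_mono) auto
  also have "\<dots> = ennreal (cmod c * (d + d))"
    using d by (simp add: ennreal_mult')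
  also have "\<dots> < ennreal e"
  proof (intro ennreal_lessI e)
    have "0 < cmod c + 1" by (simp add: add_nonneg_pos)
    then have "2 * (cmod c + 1) * d = e" unfolding d_def by simp
    then have "(d + d) * (cmod c + 1) = e" by (simp add: algebra_simps)
    then show "cmod c * (d + d) < e" using d by (simp add: algebra_simps)
  qed
  finally show ?thesis using \<open>tame g\<close> by blast
qed

text \<open>Induction along the construction of integrable functions: indicators are approximated
  directly, sums halve the tolerance, and limits spend one half on dominated convergence.\<close>

lemma tame_dense_L1:
  fixes f :: "'a::euclidean_space \<Rightarrow> complex"
  assumes "integrable lborel f" "0 < e"
  shows "\<exists>g. tame g \<and> (\<integral>\<^sup>+x. cmod (f x - g x) \<partial>lborel) < ennreal e"
  using assms
proof (induction arbitrary: e rule: integrable_induct)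
  case (base A c)
  then show ?case by (intro tame_indicator_approx) auto
next
  case (add f h)
  obtain f' where f': "tame f'" "(\<integral>\<^sup>+x. cmod (f x - f' x) \<partial>lborel) < ennreal (e / 2)"
    using add.IH(1)[of "e / 2"] add.prems by auto
  obtain h' where h': "tame h'" "(\<integral>\<^sup>+x. cmod (h x - h' x) \<partial>lborel) < ennreal (e / 2)"
    using add.IH(2)[of "e / 2"] add.prems by auto
  note [measurable] = tame_measurable[OF f'(1)] tame_measurable[OF h'(1)]
    borel_measurable_integrable[OF add.hyps(1)] borel_measurable_integrable[OF add.hyps(2)]
  have "(\<integral>\<^sup>+x. cmod (f x + h x - (f' x + h' x)) \<partial>lborel) \<le>
      (\<integral>\<^sup>+x. ennreal (cmod (f x - f' x)) + ennreal (cmod (h x - h' x)) \<partial>lborel)"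
    by (intro nn_integral_mono) (simp add: ennreal_plus[symmetric] add_diff_add norm_triangle_ineq ennreal_leI del: ennreal_plus)
  also have "\<dots> = (\<integral>\<^sup>+x. cmod (f x - f' x) \<partial>lborel) + (\<integral>\<^sup>+x. cmod (h x - h' x) \<partial>lborel)"
    by (intro nn_integral_add) auto
  also have "\<dots> < ennreal (e / 2) + ennreal (e / 2)"
    by (intro add_strict_mono f' h')
  also have "\<dots> = ennreal e" using add.prems by (simp add: ennreal_plus[symmetric] del: ennreal_plus)
  finally show ?case using tame_add[OF f'(1) h'(1)] by blast
next
  case (lim f s)
  note [measurable] = borel_measurable_integrable[OF lim.hyps(1)] borel_measurable_integrable[OF lim.hyps(4)]
  have "(\<lambda>n. \<integral>\<^sup>+x. ennreal (cmod (f x - s n x)) \<partial>lborel) \<longlonglongrightarrow> 0"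
  proof (rule nn_integral_dominated_convergence_norm[of _ _ _ "\<lambda>x. 2 * cmod (f x)"])
    show "AE x in lborel. (\<lambda>i. s i x) \<longlonglongrightarrow> f x" using lim.hyps(2) by auto
    show "AE x in lborel. cmod (s n x) \<le> 2 * cmod (f x)" for n using lim.hyps(3) by auto
    show "(\<integral>\<^sup>+x. ennreal (2 * cmod (f x)) \<partial>lborel) < \<infinity>"
      using lim.hyps(4) by (auto simp: integrable_iff_bounded ennreal_mult nn_integral_cmult ennreal_mult_less_top)
  qed auto
  then have "\<forall>\<^sub>F n in sequentially. (\<integral>\<^sup>+x. ennreal (cmod (f x - s n x)) \<partial>lborel) < ennreal (e / 2)"
    using lim.prems by (intro order_tendstoD(2)) auto
  then obtain n where n: "(\<integral>\<^sup>+x. ennreal (cmod (f x - s n x)) \<partial>lborel) < ennreal (e / 2)"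
    by (auto simp: eventually_sequentially)
  obtain h' where h': "tame h'" "(\<integral>\<^sup>+x. cmod (s n x - h' x) \<partial>lborel) < ennreal (e / 2)"
    using lim.IH[of "e / 2" n] lim.prems by auto
  note [measurable] = tame_measurable[OF h'(1)]
  have "(\<integral>\<^sup>+x. cmod (f x - h' x) \<partial>lborel) \<le>
      (\<integral>\<^sup>+x. ennreal (cmod (f x - s n x)) + ennreal (cmod (s n x - h' x)) \<partial>lborel)"
    using norm_triangle_ineq[of "f x - s n x" "s n x - h' x" for x]
    by (intro nn_integral_mono) (simp add: ennreal_plus[symmetric] ennreal_leI del: ennreal_plus)
  also have "\<dots> = (\<integral>\<^sup>+x. cmod (f x - s n x) \<partial>lborel) + (\<integral>\<^sup>+x. cmod (s n x - h' x) \<partial>lborel)"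
    by (intro nn_integral_add) auto
  also have "\<dots> < ennreal (e / 2) + ennreal (e / 2)"
    by (intro add_strict_mono n h')
  also have "\<dots> = ennreal e" using lim.prems by (simp add: ennreal_plus[symmetric] del: ennreal_plus)
  finally show ?case using h'(1) by blast
qed

text \<open>The Borel counterpart of \<open>L2\<close>: every member of \<open>L2\<close> agrees
  almost everywhere with such a function, and Borel functions compose with the parameter-dependent
  maps.\<close>

definition sqint :: "('a::euclidean_space \<Rightarrow> complex) \<Rightarrow> bool" where
  "sqint f \<longleftrightarrow> f \<in> borel_measurable borel \<and> integrable lborel (\<lambda>x. (cmod (f x))\<^sup>2)"

lemma sqintD:
  assumes "sqint f"
  shows "f \<in> borel_measurable borel" "integrable lborel (\<lambda>x. (cmod (f x))\<^sup>2)"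
    "(\<integral>\<^sup>+x. (cmod (f x))\<^sup>2 \<partial>lborel) = ennreal (\<integral>x. (cmod (f x))\<^sup>2 \<partial>lborel)"
  using assms by (auto simp: sqint_def nn_integral_eq_integral)

lemma sqint_tame: "tame f \<Longrightarrow> sqint f"
  by (simp add: sqint_def tame_measurable tame_square_integrable)

text \<open>The weighted form of the arithmetic-geometric inequality. A small \<open>d\<close> keeps
  the coefficient of the main term near 1 when \<open>b\<close> is small; \<open>d = 1\<close> gives
  the usual factor 2.\<close>

lemma norm_add_square_le:
  assumes "0 < d"
  shows "(cmod (a + b))\<^sup>2 \<le> (1 + d) * (cmod a)\<^sup>2 + (1 + 1 / d) * (cmod b)\<^sup>2"
proof -
  have "(cmod (a + b))\<^sup>2 \<le> (cmod a + cmod b)\<^sup>2"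
    by (intro power_mono norm_triangle_ineq) auto
  moreover have "2 * cmod a * cmod b \<le> d * (cmod a)\<^sup>2 + (1 / d) * (cmod b)\<^sup>2"
  proof -
    have "0 \<le> (sqrt d * cmod a - cmod b / sqrt d)\<^sup>2" by simp
    also have "\<dots> = d * (cmod a)\<^sup>2 + (1 / d) * (cmod b)\<^sup>2 - 2 * cmod a * cmod b"
      using assms by (simp add: power2_diff power_mult_distrib power_divide)
    finally show ?thesis by simp
  qed
  ultimately show ?thesis by (simp add: power2_sum algebra_simps)
qed

lemma parallelogram_law_complex:
  "(cmod (a + b))\<^sup>2 + (cmod (a - b))\<^sup>2 = 2 * (cmod a)\<^sup>2 + 2 * (cmod b)\<^sup>2"
  unfolding cmod_power2 by (simp add: power2_eq_square algebra_simps)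

lemma sqint_add:
  assumes f: "sqint f" and g: "sqint g" shows "sqint (\<lambda>x. f x + g x)"
  unfolding sqint_def
proof
  note [measurable] = sqintD(1)[OF f] sqintD(1)[OF g]
  show "(\<lambda>x. f x + g x) \<in> borel_measurable borel" by measurable
  have "integrable lborel (\<lambda>x. 2 * (cmod (f x))\<^sup>2 + 2 * (cmod (g x))\<^sup>2)"
    using sqintD(2)[OF f] sqintD(2)[OF g] by simp
  then show "integrable lborel (\<lambda>x. (cmod (f x + g x))\<^sup>2)"
    by (rule Bochner_Integration.integrable_bound)
      (use norm_add_square_le[of 1] in \<open>auto simp: abs_of_nonneg\<close>)
qed

lemma sqint_cmult: "sqint f \<Longrightarrow> sqint (\<lambda>x. c * f x)"
  by (auto simp: sqint_def norm_mult power_mult_distrib)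

lemma sqint_diff: "sqint f \<Longrightarrow> sqint g \<Longrightarrow> sqint (\<lambda>x. f x - g x)"
  using sqint_add[of f "\<lambda>x. (- 1) * g x"] sqint_cmult[of g "- 1"] by simp

lemma sqint_inner:
  assumes f: "sqint f" and g: "sqint g"
  shows "integrable lborel (\<lambda>x. f x * cnj (g x))"
    and "(ennreal (cmod (\<integral>x. f x * cnj (g x) \<partial>lborel)))\<^sup>2 \<le>
      (\<integral>\<^sup>+x. (cmod (f x))\<^sup>2 \<partial>lborel) * (\<integral>\<^sup>+x. (cmod (g x))\<^sup>2 \<partial>lborel)"
proof -
  note [measurable] = sqintD(1)[OF f] sqintD(1)[OF g]
  have "integrable lborel (\<lambda>x. (cmod (f x))\<^sup>2 + (cmod (g x))\<^sup>2)"
    using sqintD(2)[OF f] sqintD(2)[OF g] by simp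
  then show int: "integrable lborel (\<lambda>x. f x * cnj (g x))"
  proof (rule Bochner_Integration.integrable_bound)
    have "a * b \<le> a\<^sup>2 + b\<^sup>2" if "0 \<le> a" "0 \<le> b" for a b :: real
      using sum_squares_bound[of a b] mult_nonneg_nonneg[OF that] by linarith
    then show "AE x in lborel. cmod (f x * cnj (g x)) \<le> norm ((cmod (f x))\<^sup>2 + (cmod (g x))\<^sup>2)"
      by (auto simp: norm_mult)
  qed measurable
  have "ennreal (cmod (\<integral>x. f x * cnj (g x) \<partial>lborel)) \<le> (\<integral>\<^sup>+x. ennreal (cmod (f x)) * ennreal (cmod (g x)) \<partial>lborel)"
    using integral_norm_bound_ennreal[OF int] by (simp add: norm_mult ennreal_mult)
  then have "(ennreal (cmod (\<integral>x. f x * cnj (g x) \<partial>lborel)))\<^sup>2 \<le> (\<integral>\<^sup>+x. ennreal (cmod (f x)) * ennreal (cmod (g x)) \<partial>lborel)\<^sup>2"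
    by (intro power_mono) auto
  also have "\<dots> \<le> (\<integral>\<^sup>+x. (ennreal (cmod (f x)))\<^sup>2 \<partial>lborel) * (\<integral>\<^sup>+x. (ennreal (cmod (g x)))\<^sup>2 \<partial>lborel)"
    by (rule Cauchy_Schwarz_nn_integral) auto
  finally show "(ennreal (cmod (\<integral>x. f x * cnj (g x) \<partial>lborel)))\<^sup>2 \<le>
      (\<integral>\<^sup>+x. (cmod (f x))\<^sup>2 \<partial>lborel) * (\<integral>\<^sup>+x. (cmod (g x))\<^sup>2 \<partial>lborel)"
    by (simp add: ennreal_power)
qed

text \<open>Closeness in L1 does not give closeness in L2. Projecting the approximant onto the ball
  of radius \<open>B\<close> containing the values of \<open>f\<close> keeps it tame, does not
  increase the error, and bounds the error by \<open>2 * B\<close>; hence the squared error is at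
  most \<open>2 * B\<close> times the L1 error.\<close>

lemma tame_dense_bounded:
  fixes f :: "'a::euclidean_space \<Rightarrow> complex"
  assumes f: "integrable lborel f" and B: "0 < B" "\<And>x. cmod (f x) \<le> B" and e: "0 < e"
  shows "\<exists>g. tame g \<and> (\<integral>\<^sup>+x. (cmod (f x - g x))\<^sup>2 \<partial>lborel) < ennreal e"
proof -
  obtain g where g: "tame g" "(\<integral>\<^sup>+x. cmod (f x - g x) \<partial>lborel) < ennreal (e / (2 * B))"
    using tame_dense_L1[OF f, of "e / (2 * B)"] e B by auto
  note [measurable] = tame_measurable[OF g(1)] borel_measurable_integrable[OF f]
  define P where "P = closest_point (cball 0 B :: complex set)"
  have P: "convex (cball 0 B :: complex set)" "closed (cball 0 B :: complex set)" "cball 0 B \<noteq> ({} :: complex set)"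
    using B(1) by auto
  have lip: "dist (P x) (P y) \<le> dist x y" for x y
    unfolding P_def by (rule closest_point_lipschitz[OF P])
  have Pid: "P x = x" if "cmod x \<le> B" for x
    unfolding P_def using that by (intro closest_point_self) simp
  have PB: "cmod (P x) \<le> B" for x
    using closest_point_in_set[OF P(2,3), of x] by (simp add: P_def)
  \<comment> \<open>The projection fixes 0 and is 1-Lipschitz, so it preserves
    integrability.\<close>
  have Pn: "cmod (P x) \<le> cmod x" for x
    using lip[of x 0] Pid[of 0] B(1) by simp
  have cP: "continuous_on UNIV P" unfolding P_def by (rule continuous_on_closest_point[OF P])
  then have cg: "continuous_on UNIV (\<lambda>x. P (g x))"
    using g(1) by (intro continuous_on_compose2[OF cP]) (auto simp: tame_def)
  then have [measurable]: "(\<lambda>x. P (g x)) \<in> borel_measurable borel" by (rule borel_measurable_continuous_onI)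
  have "integrable lborel (\<lambda>x. P (g x))"
    using g(1) Pn by (auto simp: tame_def intro: Bochner_Integration.integrable_bound)
  then have t: "tame (\<lambda>x. P (g x))"
    unfolding tame_def using cg PB by (auto simp: bounded_iff)
  have "(cmod (f x - P (g x)))\<^sup>2 \<le> 2 * B * cmod (f x - g x)" for x
  proof -
    have "cmod (f x - P (g x)) \<le> cmod (f x - g x)"
      using lip[of "f x" "g x"] Pid[OF B(2)[of x]] by (simp add: dist_norm)
    moreover have "cmod (f x - P (g x)) \<le> 2 * B"
      using norm_triangle_ineq4[of "f x" "P (g x)"] B(2)[of x] PB[of "g x"] by simp
    ultimately show ?thesis using B(1) by (auto simp: power2_eq_square intro!: mult_mono)
  qed
  then have "(\<integral>\<^sup>+x. (cmod (f x - P (g x)))\<^sup>2 \<partial>lborel) \<le> (\<integral>\<^sup>+x. ennreal (2 * B) * cmod (f x - g x) \<partial>lborel)"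
    using B(1) by (intro nn_integral_mono) (simp add: ennreal_mult'[symmetric] ennreal_leI)
  also have "\<dots> = ennreal (2 * B) * (\<integral>\<^sup>+x. cmod (f x - g x) \<partial>lborel)"
    by (intro nn_integral_cmult) auto
  also have "\<dots> < ennreal (2 * B) * ennreal (e / (2 * B))"
    using g(2) B(1) by (intro ennreal_mult_strict_left_mono) auto
  also have "\<dots> = ennreal e" using B(1) e by (simp add: ennreal_mult'[symmetric])
  finally show ?thesis using t by blast
qed

text \<open>Cutting off both large values and large arguments makes \<open>f\<close> bounded and
  integrable, with an error that tends to 0 by dominated convergence.\<close>

lemma tame_dense_L2:
  fixes f :: "'a::euclidean_space \<Rightarrow> complex"
  assumes f: "sqint f" and e: "0 < e"
  shows "\<exists>g. tame g \<and> (\<integral>\<^sup>+x. (cmod (f x - g x))\<^sup>2 \<partial>lborel) < ennreal e"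
proof -
  note [measurable] = sqintD(1)[OF f]
  define s where "s n x = (if cmod (f x) \<le> real n \<and> norm x \<le> real n then f x else 0)" for n x
  have [measurable]: "s n \<in> borel_measurable borel" for n unfolding s_def by measurable
  have "(\<lambda>n. \<integral>\<^sup>+x. ennreal ((cmod (f x - s n x))\<^sup>2) \<partial>lborel) \<longlonglongrightarrow> (\<integral>\<^sup>+x. 0 \<partial>(lborel :: 'a measure))"
  proof (rule nn_integral_dominated_convergence[of _ _ _ "\<lambda>x. ennreal ((cmod (f x))\<^sup>2)"])
    show "(\<integral>\<^sup>+x. ennreal ((cmod (f x))\<^sup>2) \<partial>lborel) < \<infinity>" by (simp add: sqintD(3)[OF f])
    show "AE x in lborel. (\<lambda>n. ennreal ((cmod (f x - s n x))\<^sup>2)) \<longlonglongrightarrow> 0"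
    proof (rule always_eventually, rule allI)
      fix x
      obtain N :: nat where N: "max (cmod (f x)) (norm x) \<le> real N" using real_arch_simple by blast
      have "\<forall>n\<ge>N. ennreal ((cmod (f x - s n x))\<^sup>2) = 0" using N by (auto simp: s_def)
      then show "(\<lambda>n. ennreal ((cmod (f x - s n x))\<^sup>2)) \<longlonglongrightarrow> 0"
        by (intro tendsto_eventually) (auto simp: eventually_sequentially)
    qed
  qed (auto simp: s_def intro!: always_eventually)
  \<comment> \<open>Squaring a sum of two errors costs a factor 2, so each error gets a quarter of
    \<open>e\<close>.\<close>
  then have "\<forall>\<^sub>F n in sequentially. (\<integral>\<^sup>+x. ennreal ((cmod (f x - s n x))\<^sup>2) \<partial>lborel) < ennreal (e / 4)"
    using e by (intro order_tendstoD(2)) auto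
  then obtain n where n: "(\<integral>\<^sup>+x. ennreal ((cmod (f x - s n x))\<^sup>2) \<partial>lborel) < ennreal (e / 4)"
    by (auto simp: eventually_sequentially)
  \<comment> \<open>The bound \<open>Suc n\<close> is positive even for \<open>n = 0\<close>, as
    \<open>tame_dense_bounded\<close> requires.\<close>
  have B: "cmod (s n x) \<le> real (Suc n)" for x by (auto simp: s_def)
  have "integrable lborel (\<lambda>x::'a. indicator (cball 0 (real n)) x *\<^sub>R real (Suc n))"
    using emeasure_bounded_finite[of "cball (0::'a) (real n)"]
    by (intro integrable_scaleR_left integrable_indicator_iff[THEN iffD2]) auto
  then have "integrable lborel (s n)"
    by (rule Bochner_Integration.integrable_bound) (auto simp: s_def indicator_def)
  then have "\<exists>g. tame g \<and> (\<integral>\<^sup>+x. (cmod (s n x - g x))\<^sup>2 \<partial>lborel) < ennreal (e / 4)"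
    by (rule tame_dense_bounded[OF _ _ B]) (use e in auto)
  then obtain g where g: "tame g" "(\<integral>\<^sup>+x. (cmod (s n x - g x))\<^sup>2 \<partial>lborel) < ennreal (e / 4)"
    by blast
  note [measurable] = tame_measurable[OF g(1)]
  have "(cmod (f x - g x))\<^sup>2 \<le> 2 * ((cmod (f x - s n x))\<^sup>2 + (cmod (s n x - g x))\<^sup>2)" for x
    using norm_add_square_le[of 1 "f x - s n x" "s n x - g x"] by simp
  then have "(\<integral>\<^sup>+x. (cmod (f x - g x))\<^sup>2 \<partial>lborel) \<le> (\<integral>\<^sup>+x. 2 * (ennreal ((cmod (f x - s n x))\<^sup>2) + ennreal ((cmod (s n x - g x))\<^sup>2)) \<partial>lborel)"
    by (intro nn_integral_mono) (simp add: ennreal_plus[symmetric] ennreal_mult'[symmetric] ennreal_leI flip: ennreal_numeral del: ennreal_plus)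
  also have "\<dots> = 2 * ((\<integral>\<^sup>+x. (cmod (f x - s n x))\<^sup>2 \<partial>lborel) + (\<integral>\<^sup>+x. (cmod (s n x - g x))\<^sup>2 \<partial>lborel))"
    by (simp add: nn_integral_cmult nn_integral_add)
  also have "\<dots> < 2 * (ennreal (e / 4) + ennreal (e / 4))"
    by (intro ennreal_mult_strict_left_mono add_strict_mono n g) auto
  also have "\<dots> = ennreal e"
    using e by (simp add: ennreal_plus[symmetric] ennreal_mult'[symmetric] flip: ennreal_numeral del: ennreal_plus)
  finally show ?thesis using g(1) by blast
qed


text \<open>The upper bound is Fatou's lemma along tame approximations; the lower bound follows from it
  by applying the parallelogram law to \<open>g + r = f\<close> and \<open>g - r\<close>.\<close>

lemma analysis_isometry_from_tame:
  fixes \<psi> :: "'x \<Rightarrow> 'a::euclidean_space \<Rightarrow> complex"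
  assumes \<psi>: "\<And>x. x \<in> space M \<Longrightarrow> sqint (\<psi> x)"
    and meas: "\<And>f. sqint f \<Longrightarrow> (\<lambda>x. (cmod (\<integral>y. f y * cnj (\<psi> x y) \<partial>lborel))\<^sup>2) \<in> borel_measurable M"
    and iso: "\<And>f. tame f \<Longrightarrow> (\<integral>\<^sup>+x. (cmod (\<integral>y. f y * cnj (\<psi> x y) \<partial>lborel))\<^sup>2 \<partial>M) = (\<integral>\<^sup>+y. (cmod (f y))\<^sup>2 \<partial>lborel)"
    and f: "sqint f"
  shows "(\<integral>\<^sup>+x. (cmod (\<integral>y. f y * cnj (\<psi> x y) \<partial>lborel))\<^sup>2 \<partial>M) = (\<integral>\<^sup>+y. (cmod (f y))\<^sup>2 \<partial>lborel)"
proof -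
  define T where "T f x = (\<integral>y. f y * cnj (\<psi> x y) \<partial>lborel)" for f x
  define N where "N f = (\<integral>\<^sup>+x. (cmod (T f x))\<^sup>2 \<partial>M)" for f
  define a where "a f = (\<integral>y. (cmod (f y))\<^sup>2 \<partial>lborel)" for f :: "'a \<Rightarrow> complex"
  have Tm[measurable]: "sqint f \<Longrightarrow> (\<lambda>x. (cmod (T f x))\<^sup>2) \<in> borel_measurable M" for f
    using meas unfolding T_def by blast
  have Ta: "sqint f \<Longrightarrow> (\<integral>\<^sup>+y. (cmod (f y))\<^sup>2 \<partial>lborel) = ennreal (a f)" for f
    unfolding a_def by (rule sqintD(3))
  have a0: "0 \<le> a f" for f unfolding a_def by simp
  have Niso: "tame f \<Longrightarrow> N f = ennreal (a f)" for f
    using iso[of f] Ta[OF sqint_tame] unfolding N_def T_def by simp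
  have Tadd: "T (\<lambda>y. f y + g y) x = T f x + T g x" and Tdiff: "T (\<lambda>y. f y - g y) x = T f x - T g x"
    if "sqint f" "sqint g" "x \<in> space M" for f g x
    using sqint_inner(1)[OF that(1) \<psi>[OF that(3)]] sqint_inner(1)[OF that(2) \<psi>[OF that(3)]]
    unfolding T_def by (simp_all add: ring_distribs)
  have approx: "\<exists>h. tame h \<and> a (\<lambda>y. f y - h y) < e" if "sqint f" "0 < e" for f e
  proof -
    obtain h where h: "tame h" "(\<integral>\<^sup>+x. (cmod (f x - h x))\<^sup>2 \<partial>lborel) < ennreal e"
      using tame_dense_L2[OF \<open>sqint f\<close> \<open>0 < e\<close>] by blast
    then show ?thesis
      using Ta[OF sqint_diff[OF \<open>sqint f\<close> sqint_tame[OF h(1)]]] a0 by (auto simp: ennreal_less_iff)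
  qed
  have upper: "N f \<le> ennreal (a f)" if f: "sqint f" for f
  proof -
    \<comment> \<open>The square matters: with weight \<open>d = 1 / Suc k\<close> below, the error
      term becomes \<open>(1 + 1 / d) * d\<^sup>2 = (d + 1) * d\<close>, which still tends to
      0.\<close>
    have "\<exists>h. tame h \<and> a (\<lambda>y. f y - h y) < (1 / real (Suc k))\<^sup>2" for k
      by (intro approx f) simp
    then obtain h where h: "\<And>k. tame (h k)" "\<And>k. a (\<lambda>y. f y - h k y) < (1 / real (Suc k))\<^sup>2"
      by metis
    have sh: "sqint (h k)" and sd: "sqint (\<lambda>y. f y - h k y)" for k
      using sqint_tame[OF h(1)] sqint_diff[OF f] by auto
    have inv0: "(\<lambda>k. 1 / real (Suc k)) \<longlonglongrightarrow> 0"
      using LIMSEQ_inverse_real_of_nat by (simp add: inverse_eq_divide)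
    \<comment> \<open>Cauchy-Schwarz gives convergence of the coefficients at every parameter, so
      Fatou applies without passing to a subsequence.\<close>
    have lim: "(\<lambda>k. T (h k) x) \<longlonglongrightarrow> T f x" if x: "x \<in> space M" for x
    proof -
      have "cmod (T (h k) x - T f x) \<le> 1 / real (Suc k) * sqrt (a (\<psi> x))" for k
      proof -
        have "(ennreal (cmod (T (\<lambda>y. f y - h k y) x)))\<^sup>2 \<le> ennreal (a (\<lambda>y. f y - h k y)) * ennreal (a (\<psi> x))"
          using sqint_inner(2)[OF sd \<psi>[OF x], of k] unfolding T_def Ta[OF sd] Ta[OF \<psi>[OF x]] .
        then have "(cmod (T (\<lambda>y. f y - h k y) x))\<^sup>2 \<le> a (\<lambda>y. f y - h k y) * a (\<psi> x)"
          using a0 by (simp add: ennreal_power ennreal_mult[symmetric])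
        also have "\<dots> \<le> (1 / real (Suc k))\<^sup>2 * a (\<psi> x)"
          using h(2)[of k] a0 by (intro mult_right_mono) auto
        finally have "cmod (T (\<lambda>y. f y - h k y) x) \<le> sqrt ((1 / real (Suc k))\<^sup>2 * a (\<psi> x))"
          by (rule real_le_rsqrt)
        then show ?thesis
          by (simp add: Tdiff[OF f sh x] norm_minus_commute real_sqrt_mult)
      qed
      moreover have "(\<lambda>k. 1 / real (Suc k) * sqrt (a (\<psi> x))) \<longlonglongrightarrow> 0"
        using tendsto_mult_right[OF inv0, of "sqrt (a (\<psi> x))"] by simp
      ultimately have "(\<lambda>k. T (h k) x - T f x) \<longlonglongrightarrow> 0"
        by (intro Lim_null_comparison[of "\<lambda>k. T (h k) x - T f x"]) auto
      then show ?thesis by (simp add: LIM_zero_iff)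
    qed
    have "N f = (\<integral>\<^sup>+x. liminf (\<lambda>k. ennreal ((cmod (T (h k) x))\<^sup>2)) \<partial>M)"
      unfolding N_def
    proof (rule nn_integral_cong)
      fix x assume "x \<in> space M"
      then have "(\<lambda>k. ennreal ((cmod (T (h k) x))\<^sup>2)) \<longlonglongrightarrow> ennreal ((cmod (T f x))\<^sup>2)"
        by (intro tendsto_ennrealI tendsto_intros lim)
      then show "ennreal ((cmod (T f x))\<^sup>2) = liminf (\<lambda>k. ennreal ((cmod (T (h k) x))\<^sup>2))"
        by (intro lim_imp_Liminf[symmetric]) auto
    qed
    also have "\<dots> \<le> liminf (\<lambda>k. N (h k))"
      unfolding N_def using Tm[OF sh] by (intro nn_integral_liminf) simp
    also have "\<dots> \<le> liminf (\<lambda>k. ennreal ((1 + 1 / real (Suc k)) * a f + (1 / real (Suc k) + 1) * (1 / real (Suc k))))"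
    proof (intro Liminf_mono always_eventually allI)
      fix k
      define d where "d = 1 / real (Suc k)"
      have d: "0 < d" by (simp add: d_def)
      have "a (h k) \<le> (\<integral>y. (1 + d) * (cmod (f y))\<^sup>2 + (1 + 1 / d) * (cmod (f y - h k y))\<^sup>2 \<partial>lborel)"
        unfolding a_def
      proof (rule integral_mono)
        show "integrable lborel (\<lambda>y. (1 + d) * (cmod (f y))\<^sup>2 + (1 + 1 / d) * (cmod (f y - h k y))\<^sup>2)"
          using sqintD(2)[OF f] sqintD(2)[OF sd] by simp
        show "(cmod (h k y))\<^sup>2 \<le> (1 + d) * (cmod (f y))\<^sup>2 + (1 + 1 / d) * (cmod (f y - h k y))\<^sup>2" for y
          using norm_add_square_le[OF d, of "f y" "h k y - f y"] by (simp add: norm_minus_commute)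
      qed (rule sqintD(2)[OF sh])
      also have "\<dots> = (1 + d) * a f + (1 + 1 / d) * a (\<lambda>y. f y - h k y)"
        using sqintD(2)[OF f] sqintD(2)[OF sd] by (simp add: a_def)
      also have "\<dots> \<le> (1 + d) * a f + (1 + 1 / d) * d\<^sup>2"
        using h(2)[of k] d by (intro add_left_mono mult_left_mono) (auto simp: d_def)
      also have "\<dots> = (1 + d) * a f + (d + 1) * d"
        using d by (simp add: power2_eq_square field_simps)
      finally show "N (h k) \<le> ennreal ((1 + 1 / real (Suc k)) * a f + (1 / real (Suc k) + 1) * (1 / real (Suc k)))"
        unfolding Niso[OF h(1)] d_def by (rule ennreal_leI)
    qed
    also have "\<dots> = ennreal ((1 + 0) * a f + (0 + 1) * 0)"
      by (intro lim_imp_Liminf tendsto_ennrealI tendsto_intros inv0) auto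
    finally show ?thesis by simp
  qed
  \<comment> \<open>The parallelogram law gives \<open>N f + N q = 2 * N g + 2 * N r\<close> and
    likewise for \<open>a\<close>. Since \<open>N g = a g\<close> by tameness and
    \<open>N q \<le> a q\<close> by the upper bound, the loss is at most \<open>2 * a r\<close>,
    which is below \<open>2 * e\<close>.\<close>
  have lower: "ennreal (a f) \<le> N f + ennreal (2 * e)" if e: "0 < e" for e
  proof -
    obtain g where g: "tame g" "a (\<lambda>y. f y - g y) < e" using approx[OF f e] by blast
    define r where "r y = f y - g y" for y
    define q where "q y = g y - r y" for y
    have sg: "sqint g" by (rule sqint_tame[OF g(1)])
    have sr: "sqint r" unfolding r_def[abs_def] by (rule sqint_diff[OF f sg])
    have sq: "sqint q" unfolding q_def[abs_def] by (rule sqint_diff[OF sg sr])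
    note pl = parallelogram_law_complex
    have Tf: "T f x = T g x + T r x" and Tq: "T q x = T g x - T r x" if "x \<in> space M" for x
      using Tadd[OF sg sr that] Tdiff[OF sg sr that] by (simp_all add: r_def q_def[abs_def])
    have "N f + N q = (\<integral>\<^sup>+x. ennreal ((cmod (T f x))\<^sup>2) + ennreal ((cmod (T q x))\<^sup>2) \<partial>M)"
      unfolding N_def using f sq by (intro nn_integral_add[symmetric]) auto
    also have "\<dots> = (\<integral>\<^sup>+x. 2 * ennreal ((cmod (T g x))\<^sup>2) + 2 * ennreal ((cmod (T r x))\<^sup>2) \<partial>M)"
      by (intro nn_integral_cong)
        (simp add: Tf Tq pl ennreal_plus[symmetric] ennreal_mult'[symmetric] flip: ennreal_numeral del: ennreal_plus)
    also have "\<dots> = 2 * N g + 2 * N r"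
      unfolding N_def using sg sr by (simp add: nn_integral_add nn_integral_cmult)
    finally have 1: "N f + N q = 2 * N g + 2 * N r" .
    have "a f + a q = (\<integral>y. (cmod (f y))\<^sup>2 + (cmod (q y))\<^sup>2 \<partial>lborel)"
      unfolding a_def using sqintD(2)[OF f] sqintD(2)[OF sq] by simp
    also have "\<dots> = (\<integral>y. 2 * (cmod (g y))\<^sup>2 + 2 * (cmod (r y))\<^sup>2 \<partial>lborel)"
      using pl[of "g y" "r y" for y] by (intro Bochner_Integration.integral_cong) (auto simp: r_def q_def)
    also have "\<dots> = 2 * a g + 2 * a r"
      unfolding a_def using sqintD(2)[OF sg] sqintD(2)[OF sr] by simp
    finally have 2: "a f + a q = 2 * a g + 2 * a r" .
    have "ennreal (a f) + ennreal (a q) = 2 * ennreal (a g) + ennreal (2 * a r)"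
      using arg_cong[OF 2, of ennreal] a0 by (simp add: ennreal_plus ennreal_mult)
    also have "\<dots> \<le> (N f + N q) + ennreal (2 * a r)"
      unfolding 1 Niso[OF g(1)] by (intro add_right_mono) simp
    also have "\<dots> \<le> (N f + ennreal (a q)) + ennreal (2 * e)"
      using g(2) upper[OF sq] unfolding r_def[symmetric]
      by (intro add_mono ennreal_leI) auto
    finally have "ennreal (a q) + ennreal (a f) \<le> ennreal (a q) + (N f + ennreal (2 * e))"
      by (simp add: add_ac)
    \<comment> \<open>Cancellation is legitimate because \<open>a q\<close> is a real number, hence
      finite.\<close>
    then show ?thesis by (simp add: ennreal_add_left_cancel_le)
  qed
  have "ennreal (a f) \<le> N f"
  proof (rule ennreal_le_epsilon)
    show "ennreal (a f) \<le> N f + ennreal e" if "0 < e" for e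
      using lower[of "e / 2"] that by simp
  qed
  with upper[OF f] show ?thesis
    unfolding Ta[OF f] N_def T_def by (intro antisym)
qed

section \<open>Shears and dilations\<close>

definition vec_tail :: "real ^ 'n option \<Rightarrow> real ^ 'n" where
  "vec_tail x = (\<chi> k. x $ Some k)"

lemma vec_cons_nth[simp]: "vec_cons y v $ None = y" "vec_cons y v $ Some k = v $ k"
  by (auto simp: vec_cons_def)

lemma vec_tail_cons[simp]: "vec_tail (vec_cons y v) = v"
  by (simp add: vec_tail_def vec_eq_iff)

lemma vec_cons_head_tail[simp]: "vec_cons (x $ None) (vec_tail x) = x"
  by (simp add: vec_cons_def vec_tail_def vec_eq_iff split: option.split)

lemma vec_cons_eqI: "x $ None = y \<Longrightarrow> vec_tail x = v \<Longrightarrow> x = vec_cons y v"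
  using vec_cons_head_tail[of x] by simp

lemma vec_tail_linear[simp]:
  "vec_tail (x + z) = vec_tail x + vec_tail z" "vec_tail (x - z) = vec_tail x - vec_tail z"
  "vec_tail (c *\<^sub>R x) = c *\<^sub>R vec_tail x"
  by (simp_all add: vec_tail_def vec_eq_iff)

lemma continuous_vec_cons[continuous_intros]:
  assumes "continuous_on A f" "continuous_on A g"
  shows "continuous_on A (\<lambda>x. vec_cons (f x) (g x))"
  unfolding vec_cons_def
proof (rule continuous_on_vec_lambda)
  show "continuous_on A (\<lambda>x. case i of None \<Rightarrow> f x | Some k \<Rightarrow> g x $ k)" for i
    using assms by (cases i) (auto intro: continuous_intros)
qed

lemma continuous_vec_tail[continuous_intros]:
  "continuous_on A f \<Longrightarrow> continuous_on A (\<lambda>x. vec_tail (f x))"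
  unfolding vec_tail_def by (intro continuous_intros)

lemma vec_nth_measurable[measurable (raw)]:
  fixes f :: "'a \<Rightarrow> real ^ 'm::finite"
  assumes "f \<in> borel_measurable M"
  shows "(\<lambda>x. f x $ i) \<in> borel_measurable M"
  unfolding cart_eq_inner_axis using assms by measurable

lemma vec_tail_measurable[measurable]: "vec_tail \<in> borel_measurable borel"
  by (intro borel_measurable_continuous_onI continuous_intros)

lemma vec_cons_measurable[measurable]:
  assumes [measurable]: "f \<in> borel_measurable M" "g \<in> borel_measurable M"
  shows "(\<lambda>x. vec_cons (f x) (g x :: real ^ 'n::finite)) \<in> borel_measurable M"
proof -
  have "(\<lambda>p :: real \<times> (real ^ 'n). vec_cons (fst p) (snd p)) \<in> borel_measurable borel"
    by (intro borel_measurable_continuous_onI continuous_intros)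
  then have "(\<lambda>p. vec_cons (fst p) (snd p :: real ^ 'n)) \<in> borel_measurable (borel \<Otimes>\<^sub>M borel)"
    unfolding borel_prod .
  from measurable_compose[OF _ this, of "\<lambda>x. (f x, g x)" M] show ?thesis by simp
qed

section \<open>Splitting Lebesgue measure into first coordinate and tail\<close>

lemma UNIV_option_sum: "(\<Sum>i\<in>(UNIV :: 'n::finite option set). f i) = f None + (\<Sum>k\<in>UNIV. f (Some k))"
  by (simp add: UNIV_option_conv sum.reindex o_def)

lemma UNIV_option_prod: "(\<Prod>i\<in>(UNIV :: 'n::finite option set). f i) = f None * (\<Prod>k\<in>UNIV. f (Some k))"
  by (simp add: UNIV_option_conv prod.reindex o_def)

lemma inner_option: "x \<bullet> y = x $ None * y $ None + vec_tail x \<bullet> vec_tail y"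
  by (simp add: inner_vec_def UNIV_option_sum vec_tail_def)

lemma prod_Basis_vec: "(\<Prod>b\<in>(Basis :: (real ^ 'm::finite) set). f b) = (\<Prod>i\<in>UNIV. f (axis i 1))"
proof -
  have B: "(Basis :: (real ^ 'm) set) = (\<lambda>i. axis i 1) ` UNIV" by (auto simp: Basis_vec_def)
  have "inj (\<lambda>i::'m. axis i (1::real))" by (auto simp: inj_on_def axis_eq_axis)
  then show ?thesis unfolding B by (subst prod.reindex) (simp_all add: o_def)
qed

text \<open>A box in the full space corresponds to an interval times a box of tails, and the two
  volumes agree; boxes determine Lebesgue measure.\<close>

lemma lborel_vec_cons:
  "(lborel :: (real ^ 'n::finite option) measure) =
    distr (lborel \<Otimes>\<^sub>M lborel) borel (\<lambda>(y, v). vec_cons y v)"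
proof (rule lborel_eqI)
  fix l u :: "real ^ 'n option"
  assume "\<And>b. b \<in> Basis \<Longrightarrow> l \<bullet> b \<le> u \<bullet> b"
  then have lu: "l $ i \<le> u $ i" for i
    by (metis axis_in_Basis_iff inner_real_def real_inner_1_right inner_axis Basis_real_def insertI1)
  have tl: "vec_tail l \<bullet> b \<le> vec_tail u \<bullet> b" if "b \<in> Basis" for b
    using that lu by (auto simp: Basis_vec_def inner_axis vec_tail_def)
  have box: "(\<lambda>(y, v). vec_cons y v) -` box l u = {l $ None<..<u $ None} \<times> box (vec_tail l) (vec_tail u)"
    by (auto simp: mem_box_cart vec_tail_def split_option_all)
  have "emeasure (distr (lborel \<Otimes>\<^sub>M lborel) borel (\<lambda>(y, v). vec_cons y v)) (box l u) =
      emeasure lborel {l $ None<..<u $ None} * emeasure lborel (box (vec_tail l) (vec_tail u))"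
    by (subst emeasure_distr) (auto simp: space_pair_measure box lborel.emeasure_pair_measure_Times)
  also have "\<dots> = ennreal ((u $ None - l $ None) * (\<Prod>b\<in>Basis. (vec_tail u - vec_tail l) \<bullet> b))"
    using lu tl by (simp add: ennreal_mult prod_nonneg inner_diff_left)
  also have "(u $ None - l $ None) * (\<Prod>b\<in>Basis. (vec_tail u - vec_tail l) \<bullet> b) = (\<Prod>b\<in>Basis. (u - l) \<bullet> b)"
    by (simp add: prod_Basis_vec UNIV_option_prod inner_axis vec_tail_def)
  finally show "emeasure (distr (lborel \<Otimes>\<^sub>M lborel) borel (\<lambda>(y, v). vec_cons y v)) (box l u) =
      ennreal (\<Prod>b\<in>Basis. (u - l) \<bullet> b)" .
qed simp

text \<open>The first coordinate is the inner variable because, for a fixed tail, a shear acts on it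
  by a translation.\<close>

lemma nn_integral_vec_cons:
  assumes [measurable]: "F \<in> borel_measurable borel"
  shows "(\<integral>\<^sup>+x. F x \<partial>lborel) = (\<integral>\<^sup>+v. \<integral>\<^sup>+y. F (vec_cons y (v :: real ^ 'n::finite)) \<partial>lborel \<partial>lborel)"
proof -
  have m: "(\<lambda>p. F (vec_cons (fst p) (snd p :: real ^ 'n))) \<in> borel_measurable (lborel \<Otimes>\<^sub>M lborel)"
    by measurable
  have "(\<integral>\<^sup>+x. F x \<partial>lborel) = (\<integral>\<^sup>+p. F (vec_cons (fst p) (snd p :: real ^ 'n)) \<partial>(lborel \<Otimes>\<^sub>M lborel))"
    by (subst lborel_vec_cons) (simp add: nn_integral_distr case_prod_beta')
  also have "\<dots> = (\<integral>\<^sup>+v. \<integral>\<^sup>+y. F (vec_cons y (v :: real ^ 'n)) \<partial>lborel \<partial>lborel)"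
    using lborel_pair.nn_integral_snd[OF m] by simp
  finally show ?thesis .
qed

text \<open>A cylinder over a null set is null. This turns the normalisation, stated for almost
  every \<open>y\<close>, into a statement for almost every frequency.\<close>

lemma AE_head:
  assumes "AE y in lborel. P y"
  shows "AE x in (lborel :: (real ^ 'n::finite option) measure). P (x $ None)"
proof -
  obtain N where N: "N \<in> null_sets lborel" "{y. \<not> P y} \<subseteq> N"
    using assms by (auto simp: eventually_ae_filter)
  then have [measurable]: "N \<in> sets borel" by (auto simp: null_sets_def)
  have "(\<integral>\<^sup>+x. indicator N (x $ None) \<partial>(lborel :: (real ^ 'n option) measure)) = 
      (\<integral>\<^sup>+v. emeasure lborel N \<partial>(lborel :: (real ^ 'n) measure))"
    by (subst nn_integral_vec_cons) auto
  also have "\<dots> = 0" using N by (simp add: null_sets_def)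
  finally have "AE x in (lborel :: (real ^ 'n option) measure). indicator N (x $ None) = (0::ennreal)"
    by (subst (asm) nn_integral_0_iff_AE) auto
  then show ?thesis
    by eventually_elim (use N(2) in \<open>auto simp: indicator_def\<close>)
qed

text \<open>The shear by \<open>s\<close> applied after the diagonal matrix with entries
  \<open>a, b, ..., b\<close>. Keeping \<open>b\<close> independent of \<open>a\<close> lets
  \<open>a = b = 1\<close> cover the parameters at infinity.\<close>

definition shear_dil :: "real \<Rightarrow> real \<Rightarrow> real ^ 'n::finite \<Rightarrow> real ^ 'n option \<Rightarrow> real ^ 'n option" where
  "shear_dil a b s x = vec_cons (a * x $ None + b * (s \<bullet> vec_tail x)) (b *\<^sub>R vec_tail x)"

text \<open>The inverse has the same form; its shear vector is forced by the condition that
  \<open>1 / b\<close> times it be \<open>- s / a\<close>.\<close>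

definition shear_dil_inv :: "real \<Rightarrow> real \<Rightarrow> real ^ 'n::finite \<Rightarrow> real ^ 'n option \<Rightarrow> real ^ 'n option" where
  "shear_dil_inv a b s = shear_dil (1 / a) (1 / b) (- (b / a) *\<^sub>R s)"

text \<open>The transpose of \<open>shear_dil\<close>: the transposed shear first, then the diagonal
  matrix. It moves the frequency variable.\<close>

definition shear_dil_adj :: "real \<Rightarrow> real \<Rightarrow> real ^ 'n::finite \<Rightarrow> real ^ 'n option \<Rightarrow> real ^ 'n option" where
  "shear_dil_adj a b s w = vec_cons (a * w $ None) (b *\<^sub>R (vec_tail w + w $ None *\<^sub>R s))"

lemma shear_dil_inverse:
  assumes "a \<noteq> 0" "b \<noteq> 0"
  shows "shear_dil a b s (shear_dil_inv a b s x) = x" "shear_dil_inv a b s (shear_dil a b s x) = x"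
  using assms
  by (auto simp: shear_dil_inv_def shear_dil_def field_simps intro!: vec_cons_eqI[symmetric])

lemma shear_dil_adj: "shear_dil a b s x \<bullet> w = x \<bullet> shear_dil_adj a b s w"
  by (simp add: shear_dil_def shear_dil_adj_def inner_option inner_commute algebra_simps)

lemma shear_dil_measurable[measurable]:
  assumes [measurable]: "a \<in> borel_measurable M" "b \<in> borel_measurable M" "s \<in> borel_measurable M" "x \<in> borel_measurable M"
  shows "(\<lambda>p. shear_dil (a p) (b p) (s p) (x p)) \<in> borel_measurable M"
    "(\<lambda>p. shear_dil_inv (a p) (b p) (s p) (x p)) \<in> borel_measurable M"
    "(\<lambda>p. shear_dil_adj (a p) (b p) (s p) (x p)) \<in> borel_measurable M"
  unfolding shear_dil_def shear_dil_inv_def shear_dil_adj_def by measurable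

text \<open>The tail is scaled by \<open>b\<close>; for a fixed tail the first coordinate undergoes
  an affine map of slope \<open>a\<close>. The shear enters only as a translation and so contributes
  no Jacobian.\<close>

lemma lborel_shear_dil:
  fixes s :: "real ^ 'n::finite"
  assumes a: "a \<noteq> 0" and b: "b \<noteq> 0"
  shows "lborel = density (distr lborel borel (shear_dil a b s)) (\<lambda>_. ennreal (\<bar>a\<bar> * \<bar>b\<bar> ^ CARD('n)))"
proof (rule measure_eqI)
  fix A assume "A \<in> sets (lborel :: (real ^ 'n option) measure)"
  then have A[measurable]: "A \<in> sets borel" by simp
  have "emeasure lborel A = (\<integral>\<^sup>+v. \<integral>\<^sup>+y. indicator A (vec_cons y v) \<partial>lborel \<partial>lborel)"
    by (subst nn_integral_vec_cons[symmetric]) auto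
  also have "\<dots> = ennreal (\<bar>b\<bar> ^ CARD('n)) * (\<integral>\<^sup>+v. \<integral>\<^sup>+y. indicator A (vec_cons y (b *\<^sub>R v)) \<partial>lborel \<partial>lborel)"
    using nn_integral_lborel_transform[OF lborel_scale[OF b, of "0 :: real ^ 'n"],
        of "\<lambda>v. \<integral>\<^sup>+y. indicator A (vec_cons y v) \<partial>lborel"] by simp
  also have "\<dots> = ennreal (\<bar>b\<bar> ^ CARD('n)) * (\<integral>\<^sup>+v. ennreal \<bar>a\<bar> * (\<integral>\<^sup>+y. indicator A (vec_cons (b * (s \<bullet> v) + a * y) (b *\<^sub>R v)) \<partial>lborel) \<partial>lborel)"
  proof -
    have "(\<integral>\<^sup>+y. indicator A (vec_cons y (b *\<^sub>R v)) \<partial>lborel) =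
        ennreal \<bar>a\<bar> * (\<integral>\<^sup>+y. indicator A (vec_cons (b * (s \<bullet> v) + a * y) (b *\<^sub>R v)) \<partial>lborel)" for v
      by (rule nn_integral_real_affine[OF _ a]) measurable
    then show ?thesis by simp
  qed
  also have "\<dots> = ennreal (\<bar>a\<bar> * \<bar>b\<bar> ^ CARD('n)) * (\<integral>\<^sup>+v. \<integral>\<^sup>+y. indicator A (shear_dil a b s (vec_cons y v)) \<partial>lborel \<partial>lborel)"
    by (simp add: nn_integral_cmult shear_dil_def ennreal_mult mult_ac add.commute)
  also have "(\<integral>\<^sup>+v. \<integral>\<^sup>+y. indicator A (shear_dil a b s (vec_cons y v)) \<partial>lborel \<partial>lborel) = (\<integral>\<^sup>+x. indicator A (shear_dil a b s x) \<partial>lborel)"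
    by (rule nn_integral_vec_cons[symmetric]) measurable
  also have "ennreal (\<bar>a\<bar> * \<bar>b\<bar> ^ CARD('n)) * \<dots> =
      emeasure (density (distr lborel borel (shear_dil a b s)) (\<lambda>_. ennreal (\<bar>a\<bar> * \<bar>b\<bar> ^ CARD('n)))) A"
  proof -
    have "emeasure (distr lborel borel (shear_dil a b s)) A = (\<integral>\<^sup>+x. indicator A x \<partial>distr lborel borel (shear_dil a b s))"
      by simp
    also have "\<dots> = (\<integral>\<^sup>+x. indicator A (shear_dil a b s x) \<partial>lborel)"
      by (rule nn_integral_distr) auto
    finally show ?thesis by (simp add: emeasure_density nn_integral_cmult)
  qed
  finally show "emeasure lborel A = emeasure (density (distr lborel borel (shear_dil a b s)) (\<lambda>_. ennreal (\<bar>a\<bar> * \<bar>b\<bar> ^ CARD('n)))) A" .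
qed simp

lemma lborel_shear_dil_inv:
  fixes s :: "real ^ 'n::finite"
  assumes "a \<noteq> 0" and "b \<noteq> 0"
  shows "lborel = density (distr lborel borel (shear_dil_inv a b s)) (\<lambda>_. ennreal (\<bar>1 / a\<bar> * \<bar>1 / b\<bar> ^ CARD('n)))"
  unfolding shear_dil_inv_def using assms by (intro lborel_shear_dil) auto

text \<open>The substitution by \<open>shear_dil\<close> undoes the inverse inside \<open>h\<close>,
  and \<open>shear_dil_adj\<close> moves the map from the space variable to the frequency.\<close>

lemma fourier_L1_shear_dil:
  fixes s :: "real ^ 'n::finite"
  assumes a: "a \<noteq> 0" and b: "b \<noteq> 0" and [measurable]: "h \<in> borel_measurable borel"
  shows "fourier_L1 (\<lambda>x. h (shear_dil_inv a b s x)) w =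
    of_real (\<bar>a\<bar> * \<bar>b\<bar> ^ CARD('n)) * fourier_L1 h (shear_dil_adj a b s w)"
  by (simp add: fourier_L1_lborel, subst integral_lborel_transform[OF lborel_shear_dil[OF a b, of s]])
    (simp_all add: shear_dil_inverse[OF a b] scaleR_conv_of_real shear_dil_adj inner_commute[of w] inner_commute[of "shear_dil_adj a b s w"])

section \<open>Matrix formulas rewritten as explicit maps\<close>

lemma matrix_inv_eqI:
  fixes A :: "real ^ 'm::finite ^ 'm"
  assumes "\<And>x. A *v f x = x" "\<And>x. f (A *v x) = x"
  shows "matrix_inv A *v y = f y"
proof -
  \<comment> \<open>\<open>matrix_inv\<close> is a choice that means something only once an inverse
    matrix exists; in finite dimension injectivity supplies one.\<close>
  have "inj ((*v) A)" by (metis assms(2) injI)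
  then obtain B where "B ** A = mat 1" by (auto simp: matrix_left_invertible_injective[symmetric])
  then have "\<exists>B. A ** B = mat 1 \<and> B ** A = mat 1" by (auto simp: matrix_left_right_inverse)
  then have "matrix_inv A ** A = mat 1" unfolding matrix_inv_def by (rule someI2_ex) simp
  then have "matrix_inv A *v (A *v f y) = f y" by (simp add: matrix_vector_mul_assoc)
  then show ?thesis by (simp add: assms(1))
qed

lemma shear_matrix_mult: "shear_matrix s *v x = shear_dil 1 1 s x"
  unfolding shear_dil_def
  by (rule vec_cons_eqI)
    (simp_all add: matrix_vector_mult_def shear_matrix_def vec_tail_def UNIV_option_sum inner_vec_def vec_eq_iff
      if_distrib[of "\<lambda>z. z * _"] cong: if_cong)

definition dil_root :: "nat \<Rightarrow> real \<Rightarrow> real" where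
  "dil_root d a = sgn a * \<bar>a\<bar> powr (1 / real d)"

lemma dil_root_nonzero: "a \<noteq> 0 \<Longrightarrow> dil_root d a \<noteq> 0"
  by (simp add: dil_root_def sgn_zero_iff)

lemma dil_root_measurable[measurable]: "dil_root d \<in> borel_measurable borel"
  unfolding dil_root_def by measurable

lemma dilation_matrix_mult:
  "dilation_matrix a *v x = shear_dil a (dil_root CARD('n option) a) 0 (x :: real ^ 'n::finite option)"
  unfolding shear_dil_def
  by (rule vec_cons_eqI)
    (simp_all add: matrix_vector_mult_def dilation_matrix_def dil_root_def vec_tail_def UNIV_option_sum inner_vec_def vec_eq_iff
      if_distrib[of "\<lambda>z. z * _"] cong: if_cong)

lemma det_dilation_matrix:
  "\<bar>det (dilation_matrix a :: real ^ 'n::finite option ^ 'n option)\<bar> =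
    \<bar>a\<bar> * \<bar>dil_root CARD('n option) a\<bar> ^ CARD('n)"
proof -
  have "det (dilation_matrix a :: real ^ 'n option ^ 'n option) = a * dil_root CARD('n option) a ^ CARD('n)"
    by (subst det_diagonal) (auto simp: dilation_matrix_def UNIV_option_prod dil_root_def split: option.split)
  then show ?thesis by (simp add: abs_mult power_abs)
qed

lemma shearlet_system_infinity:
  "shearlet_system \<Phi> \<Psi> (\<infinity>, s, t) = (\<lambda>x. \<Phi> (shear_dil_inv 1 1 s (x - t)))"
proof -
  have "matrix_inv (shear_matrix s) *v y = shear_dil_inv 1 1 s y" for y
    by (rule matrix_inv_eqI) (simp_all add: shear_matrix_mult shear_dil_inverse)
  then show ?thesis by (simp add: fun_eq_iff)
qed

lemma shearlet_system_finite:
  fixes s :: "real ^ 'n::finite"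
  assumes a: "a \<noteq> 0"
  defines "b \<equiv> dil_root CARD('n option) a"
  shows "shearlet_system \<Phi> \<Psi> (ereal a, s, t) =
    (\<lambda>x. of_real ((\<bar>a\<bar> * \<bar>b\<bar> ^ CARD('n)) powr (- 1 / 2)) * \<Psi> (shear_dil_inv a b s (x - t)))"
proof -
  have b: "b \<noteq> 0" unfolding b_def using a by (rule dil_root_nonzero)
  have 1: "matrix_inv (shear_matrix s) *v y = shear_dil_inv 1 1 s y" for y
    by (rule matrix_inv_eqI) (simp_all add: shear_matrix_mult shear_dil_inverse)
  have 2: "matrix_inv (dilation_matrix a) *v y = shear_dil_inv a b 0 y" for y :: "real ^ 'n option"
    by (rule matrix_inv_eqI)
      (unfold dilation_matrix_mult b_def[symmetric], simp_all add: a b shear_dil_inverse)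
  \<comment> \<open>The two matrix inverses in the system collapse into one explicit map.\<close>
  have 3: "shear_dil_inv a b 0 (shear_dil_inv 1 1 s y) = shear_dil_inv a b s y" for y
    using a b by (simp add: shear_dil_inv_def shear_dil_def field_simps)
  have 4: "\<bar>det (dilation_matrix a :: real ^ 'n option ^ 'n option)\<bar> = \<bar>a\<bar> * \<bar>b\<bar> ^ CARD('n)"
    unfolding b_def by (rule det_dilation_matrix)
  show ?thesis
    by (simp add: fun_eq_iff 1 2 3 4 Let_def)
qed

section \<open>Integration over the parameters\<close>

lemma fourier_L1_cmult:
  assumes [measurable]: "h \<in> borel_measurable borel"
  shows "fourier_L1 (\<lambda>x. c * h x) w = c * fourier_L1 h w"
  by (simp add: fourier_L1_lborel mult.assoc)

text \<open>The Jacobian appears inside the square because it comes from transforming the dilated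
  generator. Choosing \<open>c\<close> as its inverse square root later leaves exactly one
  Jacobian.\<close>

lemma correlation_shear_dil:
  fixes f h :: "real ^ 'n::finite option \<Rightarrow> complex"
  assumes f: "tame f" and h: "integrable lborel h" and a: "a \<noteq> 0" and b: "b \<noteq> 0"
  shows "(\<integral>\<^sup>+t. (cmod (\<integral>x. f x * cnj (of_real c * h (shear_dil_inv a b s (x - t))) \<partial>lborel))\<^sup>2 \<partial>lborel) =
    (\<integral>\<^sup>+w. ennreal ((cmod (fourier_L1 f w))\<^sup>2) *
      ennreal ((c * (\<bar>a\<bar> * \<bar>b\<bar> ^ CARD('n)))\<^sup>2 * (cmod (fourier_L1 h (shear_dil_adj a b s w)))\<^sup>2) \<partial>lborel)"
proof -
  have [measurable]: "h \<in> borel_measurable borel" using h by auto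
  have "integrable lborel (\<lambda>x. h (shear_dil_inv a b s x))"
    using integrable_lborel_transform[OF lborel_shear_dil_inv[OF a b, of s], of h] h a b by simp
  then have "integrable lborel (\<lambda>x. of_real c * h (shear_dil_inv a b s x))" by simp
  note correlation_Plancherel[OF f this]
  then show ?thesis
    by (simp add: fourier_L1_cmult fourier_L1_shear_dil[OF a b] norm_mult norm_power power_mult_distrib abs_mult power_abs mult.assoc)
qed

text \<open>Substitution of the whole argument for \<open>s\<close>, an affine map of slope
  \<open>b * y\<close>. It degenerates at \<open>y = 0\<close>, so the hyperplane of frequencies
  with vanishing first coordinate must be set aside.\<close>

lemma nn_integral_shear_variable:
  fixes G :: "real ^ 'n::finite \<Rightarrow> ennreal"
  assumes [measurable]: "G \<in> borel_measurable borel" and b: "b \<noteq> 0" and y: "y \<noteq> 0"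
  shows "(\<integral>\<^sup>+s. G (b *\<^sub>R (v + y *\<^sub>R s)) \<partial>lborel) = ennreal (1 / (\<bar>b\<bar> * \<bar>y\<bar>) ^ CARD('n)) * (\<integral>\<^sup>+\<sigma>. G \<sigma> \<partial>lborel)"
proof -
  have "(\<integral>\<^sup>+\<sigma>. G \<sigma> \<partial>lborel) = ennreal ((\<bar>b\<bar> * \<bar>y\<bar>) ^ CARD('n)) * (\<integral>\<^sup>+s. G (b *\<^sub>R (v + y *\<^sub>R s)) \<partial>lborel)"
    using nn_integral_lborel_transform[OF lborel_scale[of "b * y" "b *\<^sub>R v"], of G] b y
    by (simp add: abs_mult scaleR_add_right)
  then show ?thesis
    using b y by (simp add: mult.assoc[symmetric] ennreal_mult'[symmetric])
qed

text \<open>The Jacobian \<open>\<bar>b\<bar> ^ CARD('n)\<close> of \<open>\<sigma> = b (\<omega> + y s)\<close> cancels against the determinant,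
  so only \<open>\<bar>a\<bar> / \<bar>a\<bar> ^ (CARD('n option) + 1)\<close> is left for the substitution \<open>\<xi> = a y\<close>.\<close>

lemma nn_integral_shear_dil_parameters:
  fixes q :: "real ^ 'n::finite option \<Rightarrow> real"
  assumes [measurable]: "q \<in> borel_measurable borel" "\<beta> \<in> borel_measurable borel"
    and q: "\<And>x. 0 \<le> q x" and \<beta>: "\<And>a. a \<noteq> 0 \<Longrightarrow> \<beta> a \<noteq> 0" and y: "w $ None \<noteq> 0"
  shows "(\<integral>\<^sup>+s. (\<integral>\<^sup>+a\<in>{-1..1} - {0}.
      ennreal (\<bar>a\<bar> * \<bar>\<beta> a\<bar> ^ CARD('n) * q (shear_dil_adj a (\<beta> a) s w)) *
      ennreal (1 / \<bar>a\<bar> ^ (CARD('n option) + 1)) \<partial>lborel) \<partial>lborel) =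
    (\<integral>\<^sup>+\<sigma>. (\<integral>\<^sup>+\<xi>\<in>{-\<bar>w $ None\<bar>..\<bar>w $ None\<bar>}.
      ennreal (q (vec_cons \<xi> \<sigma>) / \<bar>\<xi>\<bar> ^ CARD('n option)) \<partial>lborel) \<partial>lborel)"
proof -
  define z where "z = w $ None"
  have z: "z \<noteq> 0" using y by (simp add: z_def)
  define A where "A = {-1..1} - {0::real}"
  have [measurable]: "A \<in> sets borel" by (simp add: A_def)
  let ?w = "\<lambda>a::real. ennreal (1 / \<bar>a\<bar> ^ (CARD('n option) + 1))"
  let ?J = "\<lambda>a. ennreal (\<bar>a\<bar> * \<bar>\<beta> a\<bar> ^ CARD('n))"
  have "(\<integral>\<^sup>+s. (\<integral>\<^sup>+a\<in>A. ennreal (\<bar>a\<bar> * \<bar>\<beta> a\<bar> ^ CARD('n) * q (shear_dil_adj a (\<beta> a) s w)) * ?w a \<partial>lborel) \<partial>lborel) =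
      (\<integral>\<^sup>+a. \<integral>\<^sup>+s. ennreal (\<bar>a\<bar> * \<bar>\<beta> a\<bar> ^ CARD('n) * q (shear_dil_adj a (\<beta> a) s w)) * ?w a * indicator A a \<partial>lborel \<partial>lborel)"
    by (rule lborel_pair.Fubini') measurable
  also have "\<dots> = (\<integral>\<^sup>+a. \<integral>\<^sup>+\<sigma>. ennreal (q (vec_cons (a * z) \<sigma>)) * ennreal (1 / (\<bar>a\<bar> ^ CARD('n option) * \<bar>z\<bar> ^ CARD('n))) * indicator A a \<partial>lborel \<partial>lborel)"
  proof (rule nn_integral_cong)
    fix a :: real
    show "(\<integral>\<^sup>+s. ennreal (\<bar>a\<bar> * \<bar>\<beta> a\<bar> ^ CARD('n) * q (shear_dil_adj a (\<beta> a) s w)) * ?w a * indicator A a \<partial>lborel) =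
      (\<integral>\<^sup>+\<sigma>. ennreal (q (vec_cons (a * z) \<sigma>)) * ennreal (1 / (\<bar>a\<bar> ^ CARD('n option) * \<bar>z\<bar> ^ CARD('n))) * indicator A a \<partial>lborel)"
    proof (cases "a \<in> A")
      case True
      then have a: "a \<noteq> 0" by (simp add: A_def)
      let ?G = "\<lambda>\<sigma>. ennreal (q (vec_cons (a * z) \<sigma>))"
      have "(\<integral>\<^sup>+s. ennreal (\<bar>a\<bar> * \<bar>\<beta> a\<bar> ^ CARD('n) * q (shear_dil_adj a (\<beta> a) s w)) * ?w a * indicator A a \<partial>lborel) =
          (\<integral>\<^sup>+s. (?J a * ?w a) * ?G (\<beta> a *\<^sub>R (vec_tail w + z *\<^sub>R s)) \<partial>lborel)"
        using True q by (intro nn_integral_cong) (simp add: shear_dil_adj_def z_def ennreal_mult mult_ac)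
      also have "\<dots> = (?J a * ?w a) * (ennreal (1 / (\<bar>\<beta> a\<bar> * \<bar>z\<bar>) ^ CARD('n)) * (\<integral>\<^sup>+\<sigma>. ?G \<sigma> \<partial>lborel))"
        by (subst nn_integral_cmult) (simp_all add: nn_integral_shear_variable[of ?G, OF _ \<beta>[OF a] z])
      also have "\<dots> = ennreal (1 / (\<bar>a\<bar> ^ CARD('n option) * \<bar>z\<bar> ^ CARD('n))) * (\<integral>\<^sup>+\<sigma>. ?G \<sigma> \<partial>lborel)"
      proof -
        \<comment> \<open>Bookkeeping for \<open>x = \<bar>a\<bar>\<close>,
          \<open>B = \<bar>\<beta> a\<bar>\<close>, \<open>Z = \<bar>z\<bar>\<close>: determinant,
          measure density and shear Jacobian multiply to a weight free of \<open>B\<close>.\<close>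
        have r: "x * B ^ n * (1 / x ^ (m + 1)) * (1 / (B * Z) ^ n) = 1 / (x ^ m * Z ^ n)"
          if "x \<noteq> 0" "B \<noteq> 0" for x B Z :: real and m n
          using that by (simp add: power_mult_distrib)
        have "?J a * ?w a * ennreal (1 / (\<bar>\<beta> a\<bar> * \<bar>z\<bar>) ^ CARD('n)) = ennreal (1 / (\<bar>a\<bar> ^ CARD('n option) * \<bar>z\<bar> ^ CARD('n)))"
          by ((subst ennreal_mult'[symmetric], simp)+, subst r) (simp_all add: a \<beta>[OF a])
        then show ?thesis by (simp only: mult.assoc[symmetric])
      qed
      also have "\<dots> = (\<integral>\<^sup>+\<sigma>. ?G \<sigma> * ennreal (1 / (\<bar>a\<bar> ^ CARD('n option) * \<bar>z\<bar> ^ CARD('n))) * indicator A a \<partial>lborel)"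
        using True by (simp add: nn_integral_multc mult.commute)
      finally show ?thesis .
    qed simp
  qed
  also have "\<dots> = (\<integral>\<^sup>+\<sigma>. \<integral>\<^sup>+a. ennreal (q (vec_cons (a * z) \<sigma>)) * ennreal (1 / (\<bar>a\<bar> ^ CARD('n option) * \<bar>z\<bar> ^ CARD('n))) * indicator A a \<partial>lborel \<partial>lborel)"
    by (rule lborel_pair.Fubini') measurable
  also have "\<dots> = (\<integral>\<^sup>+\<sigma>. (\<integral>\<^sup>+\<xi>\<in>{-\<bar>z\<bar>..\<bar>z\<bar>}. ennreal (q (vec_cons \<xi> \<sigma>) / \<bar>\<xi>\<bar> ^ CARD('n option)) \<partial>lborel) \<partial>lborel)"
  proof (rule nn_integral_cong)
    fix \<sigma> :: "real ^ 'n"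
    \<comment> \<open>Substitution \<xi> = z a: one factor \<open>\<bar>z\<bar>\<close> of the
      denominator is absorbed by the Jacobian, leaving the power \<open>CARD('n)\<close>.\<close>
    have "(\<integral>\<^sup>+\<xi>\<in>{-\<bar>z\<bar>..\<bar>z\<bar>}. ennreal (q (vec_cons \<xi> \<sigma>) / \<bar>\<xi>\<bar> ^ CARD('n option)) \<partial>lborel) =
        ennreal \<bar>z\<bar> * (\<integral>\<^sup>+a. ennreal (q (vec_cons (0 + z * a) \<sigma>) / \<bar>0 + z * a\<bar> ^ CARD('n option)) * indicator {-\<bar>z\<bar>..\<bar>z\<bar>} (0 + z * a) \<partial>lborel)"
      by (rule nn_integral_real_affine[OF _ z]) measurable
    also have "\<dots> = (\<integral>\<^sup>+a. ennreal \<bar>z\<bar> * (ennreal (q (vec_cons (0 + z * a) \<sigma>) / \<bar>0 + z * a\<bar> ^ CARD('n option)) * indicator {-\<bar>z\<bar>..\<bar>z\<bar>} (0 + z * a)) \<partial>lborel)"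
      by (rule nn_integral_cmult[symmetric]) measurable
    also have "\<dots> = (\<integral>\<^sup>+a. ennreal (q (vec_cons (a * z) \<sigma>)) * ennreal (1 / (\<bar>a\<bar> ^ CARD('n option) * \<bar>z\<bar> ^ CARD('n))) * indicator A a \<partial>lborel)"
    proof (rule nn_integral_cong)
      fix a :: real
      have "0 + z * a \<in> {-\<bar>z\<bar>..\<bar>z\<bar>} \<longleftrightarrow> a \<in> {-1..1}"
      proof -
        have "0 + z * a \<in> {-\<bar>z\<bar>..\<bar>z\<bar>} \<longleftrightarrow> \<bar>z\<bar> * \<bar>a\<bar> \<le> \<bar>z\<bar> * 1" by (auto simp: abs_mult[symmetric])
        also have "\<dots> \<longleftrightarrow> \<bar>a\<bar> \<le> 1" using z by (subst mult_le_cancel_left_pos) auto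
        finally show ?thesis by auto
      qed
      then have ind: "indicator {-\<bar>z\<bar>..\<bar>z\<bar>} (0 + z * a) = (indicator {-1..1} a :: ennreal)"
        by (simp add: indicator_def)
      show "ennreal \<bar>z\<bar> * (ennreal (q (vec_cons (0 + z * a) \<sigma>) / \<bar>0 + z * a\<bar> ^ CARD('n option)) * indicator {-\<bar>z\<bar>..\<bar>z\<bar>} (0 + z * a)) =
          ennreal (q (vec_cons (a * z) \<sigma>)) * ennreal (1 / (\<bar>a\<bar> ^ CARD('n option) * \<bar>z\<bar> ^ CARD('n))) * indicator A a"
      \<comment> \<open>At 0 both sides vanish: the right through the indicator of \<open>A\<close>,
        the left because division by zero gives 0.\<close>
      proof (cases "a = 0")
        case False
        then have "indicator A a = (indicator {-1..1} a :: ennreal)" by (simp add: A_def indicator_def)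
        moreover have "\<bar>z\<bar> * (q (vec_cons (z * a) \<sigma>) / \<bar>z * a\<bar> ^ CARD('n option)) =
            q (vec_cons (a * z) \<sigma>) * (1 / (\<bar>a\<bar> ^ CARD('n option) * \<bar>z\<bar> ^ CARD('n)))"
          using z False by (simp add: abs_mult power_mult_distrib mult.commute[of z a])
        ultimately show ?thesis
          unfolding ind using q by (simp only: mult.assoc[symmetric] ennreal_mult'[symmetric] abs_ge_zero add_0)
      qed (simp add: A_def)
    qed
    finally show "(\<integral>\<^sup>+a. ennreal (q (vec_cons (a * z) \<sigma>)) * ennreal (1 / (\<bar>a\<bar> ^ CARD('n option) * \<bar>z\<bar> ^ CARD('n))) * indicator A a \<partial>lborel) =
      (\<integral>\<^sup>+\<xi>\<in>{-\<bar>z\<bar>..\<bar>z\<bar>}. ennreal (q (vec_cons \<xi> \<sigma>) / \<bar>\<xi>\<bar> ^ CARD('n option)) \<partial>lborel)" by simp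
  qed
  finally show ?thesis unfolding A_def z_def .
qed

text \<open>The shear substitution with \<open>b = 1\<close>; the exponent
  \<open>CARD('n option) - 1\<close> is \<open>CARD('n)\<close>, the dimension of the shear
  variable.\<close>

lemma nn_integral_shear_parameters:
  fixes p :: "real ^ 'n::finite option \<Rightarrow> real"
  assumes [measurable]: "p \<in> borel_measurable borel" and p: "\<And>x. 0 \<le> p x" and y: "w $ None \<noteq> 0"
  shows "(\<integral>\<^sup>+s. ennreal (p (shear_dil_adj 1 1 s w)) \<partial>lborel) =
    (\<integral>\<^sup>+\<sigma>. ennreal (p (vec_cons (w $ None) \<sigma>) / \<bar>w $ None\<bar> ^ (CARD('n option) - 1)) \<partial>lborel)"
proof -
  have "(\<integral>\<^sup>+s. ennreal (p (shear_dil_adj 1 1 s w)) \<partial>lborel) =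
      ennreal (1 / \<bar>w $ None\<bar> ^ CARD('n)) * (\<integral>\<^sup>+\<sigma>. ennreal (p (vec_cons (w $ None) \<sigma>)) \<partial>lborel)"
    using nn_integral_shear_variable[of "\<lambda>\<sigma>. ennreal (p (vec_cons (w $ None) \<sigma>))" 1 "w $ None" "vec_tail w"] y
    by (simp add: shear_dil_adj_def)
  also have "\<dots> = (\<integral>\<^sup>+\<sigma>. ennreal (1 / \<bar>w $ None\<bar> ^ CARD('n)) * ennreal (p (vec_cons (w $ None) \<sigma>)) \<partial>lborel)"
    by (rule nn_integral_cmult[symmetric]) measurable
  finally show ?thesis by (simp add: ennreal_mult'[symmetric] p)
qed

text \<open>The matrix-free form of \<open>shearlet_system\<close>: it is visibly jointly measurable in parameter and argument,
  and agrees with \<open>shearlet_system\<close> on \<open>param_space\<close>.\<close>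

definition shearlet_map ::
  "(real ^ 'n::finite option \<Rightarrow> complex) \<Rightarrow> (real ^ 'n option \<Rightarrow> complex) \<Rightarrow>
    'n param \<Rightarrow> real ^ 'n option \<Rightarrow> complex" where
  "shearlet_map \<Phi> \<Psi> p y = (let a = real_of_ereal (fst p); b = dil_root CARD('n option) a;
      s = fst (snd p); t = snd (snd p) in
    if fst p = \<infinity> then \<Phi> (shear_dil_inv 1 1 s (y - t))
    else of_real ((\<bar>a\<bar> * \<bar>b\<bar> ^ CARD('n)) powr (- 1 / 2)) * \<Psi> (shear_dil_inv a b s (y - t)))"

lemma shearlet_map_eq:
  fixes p :: "'n::finite param"
  assumes "p \<in> param_space"
  shows "shearlet_map \<Phi> \<Psi> p = shearlet_system \<Phi> \<Psi> p"
proof -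
  obtain \<alpha> s t where p: "p = (\<alpha>, s, t)" by (cases p)
  consider "\<alpha> = \<infinity>" | a where "\<alpha> = ereal a" "a \<noteq> 0"
    using assms by (auto simp: p param_space_def)
  then show ?thesis
  proof cases
    case 1
    then show ?thesis
      unfolding p 1 shearlet_system_infinity by (simp add: shearlet_map_def fun_eq_iff)
  next
    case 2
    show ?thesis
      unfolding p 2(1) shearlet_system_finite[OF 2(2)] by (simp add: shearlet_map_def fun_eq_iff Let_def)
  qed
qed

lemma shearlet_map_measurable:
  fixes \<Phi> \<Psi> :: "real ^ 'n::finite option \<Rightarrow> complex"
  assumes [measurable]: "\<Phi> \<in> borel_measurable borel" "\<Psi> \<in> borel_measurable borel"
  shows "(\<lambda>(p, y). shearlet_map \<Phi> \<Psi> p y) \<in> borel_measurable (borel \<Otimes>\<^sub>M borel)"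
  \<comment> \<open>The Borel algebra on parameter triples is split into a product so that
    measurability can be checked coordinatewise.\<close>
  unfolding shearlet_map_def Let_def borel_prod[symmetric, where 'a=ereal]
    borel_prod[symmetric, where 'a="real ^ 'n" and 'b="real ^ 'n option"] case_prod_beta'
  by measurable

lemma shearlet_coefficient_measurable:
  fixes \<Phi> \<Psi> f :: "real ^ 'n::finite option \<Rightarrow> complex"
  assumes [measurable]: "\<Phi> \<in> borel_measurable borel" "\<Psi> \<in> borel_measurable borel" "f \<in> borel_measurable borel"
  shows "(\<lambda>p. (cmod (\<integral>y. f y * cnj (shearlet_map \<Phi> \<Psi> p y) \<partial>lborel))\<^sup>2) \<in> borel_measurable borel"
proof -
  note [measurable] = shearlet_map_measurable[OF assms(1,2)]
  have "(\<lambda>p. \<integral>y. f y * cnj (shearlet_map \<Phi> \<Psi> p y) \<partial>lborel) \<in> borel_measurable borel"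
    by (rule lborel.borel_measurable_lebesgue_integral) measurable
  then show ?thesis by measurable
qed

lemma borel_measurable_param_measureI:
  assumes "f \<in> borel_measurable borel"
  shows "f \<in> borel_measurable (param_measure :: 'n::finite param measure)"
  using measurable_restrict_space1[OF assms] measurable_cong_sets[OF sets_param_measure refl] by blast

text \<open>In \<open>param_integral\<close> the variable \<open>t\<close> is outermost. It has to
  become innermost for Plancherel, and the frequency that replaces it has to become outermost again,
  so each part is interchanged in both directions. All integrands are nonnegative, so Tonelli
  suffices.\<close>

lemma tame_param_integral:
  fixes \<Phi> \<Psi> f :: "real ^ 'n::finite option \<Rightarrow> complex"
  assumes \<Phi>: "integrable lborel \<Phi>" and \<Psi>: "integrable lborel \<Psi>" and f: "tame f"
    and calderon: "AE y in lborel.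
      (\<integral>\<^sup>+\<sigma>. ennreal ((cmod (fourier_L1 \<Phi> (vec_cons y \<sigma>)))\<^sup>2 / \<bar>y\<bar> ^ (CARD('n option) - 1)) \<partial>lborel) +
      (\<integral>\<^sup>+\<sigma>. (\<integral>\<^sup>+\<xi>\<in>{-\<bar>y\<bar>..\<bar>y\<bar>}.
         ennreal ((cmod (fourier_L1 \<Psi> (vec_cons \<xi> \<sigma>)))\<^sup>2 / \<bar>\<xi>\<bar> ^ CARD('n option)) \<partial>lborel) \<partial>lborel) = 1"
  shows "param_integral (\<lambda>p. ennreal ((cmod (\<integral>y. f y * cnj (shearlet_map \<Phi> \<Psi> p y) \<partial>lborel))\<^sup>2)) =
    (\<integral>\<^sup>+y. (cmod (f y))\<^sup>2 \<partial>lborel)"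
proof -
  have \<Phi>m[measurable]: "\<Phi> \<in> borel_measurable borel" and \<Psi>m[measurable]: "\<Psi> \<in> borel_measurable borel"
    using \<Phi> \<Psi> by auto
  note fm[measurable] = tame_measurable[OF f]
  define F where "F p = ennreal ((cmod (\<integral>y. f y * cnj (shearlet_map \<Phi> \<Psi> p y) \<partial>lborel))\<^sup>2)" for p
  have [measurable]: "F \<in> borel_measurable borel"
    unfolding F_def using shearlet_coefficient_measurable[OF \<Phi>m \<Psi>m fm] by measurable
  then have F3: "F \<in> borel_measurable (borel \<Otimes>\<^sub>M borel \<Otimes>\<^sub>M borel)"
    by (simp only: borel_prod)
  have F'[measurable]: "(\<lambda>x. F (g x, h x, k x)) \<in> borel_measurable M"
    if [measurable]: "g \<in> borel_measurable M" "h \<in> borel_measurable M" "k \<in> borel_measurable M" for g h k and M :: "'c measure"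
    by (rule measurable_compose[OF _ F3, of "\<lambda>x. (g x, h x, k x)" M]) measurable
  define A where "A = {-1..1} - {0::real}"
  have [measurable]: "A \<in> sets borel" by (simp add: A_def)
  define \<beta> where "\<beta> = dil_root CARD('n option)"
  have \<beta>m[measurable]: "\<beta> \<in> borel_measurable borel" unfolding \<beta>_def by measurable
  have \<beta>: "\<beta> a \<noteq> 0" if "a \<noteq> 0" for a using dil_root_nonzero[OF that] by (simp add: \<beta>_def)
  define e where "e w = ennreal ((cmod (fourier_L1 f w))\<^sup>2)" for w
  define p where "p w = (cmod (fourier_L1 \<Phi> w))\<^sup>2" for w
  define q where "q w = (cmod (fourier_L1 \<Psi> w))\<^sup>2" for w
  note [measurable] = fourier_L1_measurable[OF fm] fourier_L1_measurable[OF \<Phi>m] fourier_L1_measurable[OF \<Psi>m]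
  have [measurable]: "e \<in> borel_measurable borel" "p \<in> borel_measurable borel" "q \<in> borel_measurable borel"
    unfolding e_def p_def q_def by measurable
  let ?w = "\<lambda>a::real. ennreal (1 / \<bar>a\<bar> ^ (CARD('n option) + 1))"
  let ?Q = "\<lambda>w s a. ennreal (\<bar>a\<bar> * \<bar>\<beta> a\<bar> ^ CARD('n) * q (shear_dil_adj a (\<beta> a) s w))"
  have inf: "(\<integral>\<^sup>+t. F (\<infinity>, s, t) \<partial>lborel) = (\<integral>\<^sup>+w. e w * ennreal (p (shear_dil_adj 1 1 s w)) \<partial>lborel)" for s
    using correlation_shear_dil[OF f \<Phi>, of 1 1 1 s]
    by (simp add: F_def shearlet_map_def e_def p_def)
  have fin: "(\<integral>\<^sup>+t. F (ereal a, s, t) \<partial>lborel) = (\<integral>\<^sup>+w. e w * ?Q w s a \<partial>lborel)" if a: "a \<noteq> 0" for a s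
  proof -
    define D where "D = \<bar>a\<bar> * \<bar>\<beta> a\<bar> ^ CARD('n)"
    have "0 < D" using a \<beta>[OF a] by (simp add: D_def)
    \<comment> \<open>The normalisation \<open>D powr (- 1 / 2)\<close> times the Jacobian
      \<open>D\<close> is the square root of \<open>D\<close>.\<close>
    then have D: "(D powr (- 1 / 2) * D)\<^sup>2 = D"
      by (simp add: power_mult_distrib powr_minus powr_half_sqrt field_simps power2_eq_square[of D])
    show ?thesis
      using correlation_shear_dil[OF f \<Psi> a \<beta>[OF a], of "D powr (- 1 / 2)" s]
      unfolding D_def[symmetric] D
      by (simp add: F_def shearlet_map_def e_def q_def \<beta>_def Let_def D_def)
  qed
  have "param_integral F = (\<integral>\<^sup>+t. \<integral>\<^sup>+s. F (\<infinity>, s, t) \<partial>lborel \<partial>lborel) +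
      (\<integral>\<^sup>+t. \<integral>\<^sup>+s. (\<integral>\<^sup>+a\<in>A. F (ereal a, s, t) * ?w a \<partial>lborel) \<partial>lborel \<partial>lborel)"
    by (simp add: param_integral_def A_def)
  also have "(\<integral>\<^sup>+t. \<integral>\<^sup>+s. F (\<infinity>, s, t) \<partial>lborel \<partial>lborel) = (\<integral>\<^sup>+s. \<integral>\<^sup>+t. F (\<infinity>, s, t) \<partial>lborel \<partial>lborel)"
    by (rule lborel_pair.Fubini') measurable
  also have "\<dots> = (\<integral>\<^sup>+w. \<integral>\<^sup>+s. e w * ennreal (p (shear_dil_adj 1 1 s w)) \<partial>lborel \<partial>lborel)"
    unfolding inf by (rule lborel_pair.Fubini') measurable
  also have "\<dots> = (\<integral>\<^sup>+w. e w * (\<integral>\<^sup>+s. ennreal (p (shear_dil_adj 1 1 s w)) \<partial>lborel) \<partial>lborel)"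
    by (intro nn_integral_cong nn_integral_cmult) measurable
  also have "(\<integral>\<^sup>+t. \<integral>\<^sup>+s. (\<integral>\<^sup>+a\<in>A. F (ereal a, s, t) * ?w a \<partial>lborel) \<partial>lborel \<partial>lborel) =
      (\<integral>\<^sup>+s. \<integral>\<^sup>+t. (\<integral>\<^sup>+a\<in>A. F (ereal a, s, t) * ?w a \<partial>lborel) \<partial>lborel \<partial>lborel)"
    by (rule lborel_pair.Fubini') measurable
  also have "\<dots> = (\<integral>\<^sup>+s. \<integral>\<^sup>+a. \<integral>\<^sup>+t. F (ereal a, s, t) * ?w a * indicator A a \<partial>lborel \<partial>lborel \<partial>lborel)"
    by (intro nn_integral_cong lborel_pair.Fubini') measurable
  also have "\<dots> = (\<integral>\<^sup>+s. \<integral>\<^sup>+a. \<integral>\<^sup>+w. e w * (?Q w s a * ?w a * indicator A a) \<partial>lborel \<partial>lborel \<partial>lborel)"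
  proof (rule nn_integral_cong, rule nn_integral_cong)
    fix s :: "real ^ 'n" and a :: real
    show "(\<integral>\<^sup>+t. F (ereal a, s, t) * ?w a * indicator A a \<partial>lborel) = (\<integral>\<^sup>+w. e w * (?Q w s a * ?w a * indicator A a) \<partial>lborel)"
    proof (cases "a \<in> A")
      case True
      then have a: "a \<noteq> 0" by (simp add: A_def)
      have "(\<integral>\<^sup>+t. F (ereal a, s, t) * ?w a * indicator A a \<partial>lborel) = (\<integral>\<^sup>+t. F (ereal a, s, t) * ?w a \<partial>lborel)"
        using True by simp
      also have "\<dots> = (\<integral>\<^sup>+w. e w * ?Q w s a \<partial>lborel) * ?w a"
        unfolding fin[OF a, symmetric] by (rule nn_integral_multc) measurable
      also have "\<dots> = (\<integral>\<^sup>+w. e w * ?Q w s a * ?w a \<partial>lborel)"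
        by (rule nn_integral_multc[symmetric]) measurable
      finally show ?thesis using True by (simp add: mult.assoc)
    qed simp
  qed
  also have "\<dots> = (\<integral>\<^sup>+s. \<integral>\<^sup>+w. \<integral>\<^sup>+a. e w * (?Q w s a * ?w a * indicator A a) \<partial>lborel \<partial>lborel \<partial>lborel)"
    by (intro nn_integral_cong lborel_pair.Fubini') measurable
  also have "\<dots> = (\<integral>\<^sup>+w. \<integral>\<^sup>+s. \<integral>\<^sup>+a. e w * (?Q w s a * ?w a * indicator A a) \<partial>lborel \<partial>lborel \<partial>lborel)"
    by (rule lborel_pair.Fubini') measurable
  also have "\<dots> = (\<integral>\<^sup>+w. e w * (\<integral>\<^sup>+s. (\<integral>\<^sup>+a\<in>A. ?Q w s a * ?w a \<partial>lborel) \<partial>lborel) \<partial>lborel)"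
  proof (rule nn_integral_cong)
    fix w
    have "(\<integral>\<^sup>+s. \<integral>\<^sup>+a. e w * (?Q w s a * ?w a * indicator A a) \<partial>lborel \<partial>lborel) =
        (\<integral>\<^sup>+s. e w * (\<integral>\<^sup>+a\<in>A. ?Q w s a * ?w a \<partial>lborel) \<partial>lborel)"
      by (intro nn_integral_cong nn_integral_cmult) measurable
    also have "\<dots> = e w * (\<integral>\<^sup>+s. (\<integral>\<^sup>+a\<in>A. ?Q w s a * ?w a \<partial>lborel) \<partial>lborel)"
      by (rule nn_integral_cmult) measurable
    finally show "(\<integral>\<^sup>+s. \<integral>\<^sup>+a. e w * (?Q w s a * ?w a * indicator A a) \<partial>lborel \<partial>lborel) =
        e w * (\<integral>\<^sup>+s. (\<integral>\<^sup>+a\<in>A. ?Q w s a * ?w a \<partial>lborel) \<partial>lborel)" .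
  qed
  also have "(\<integral>\<^sup>+w. e w * (\<integral>\<^sup>+s. ennreal (p (shear_dil_adj 1 1 s w)) \<partial>lborel) \<partial>lborel) +
      (\<integral>\<^sup>+w. e w * (\<integral>\<^sup>+s. (\<integral>\<^sup>+a\<in>A. ?Q w s a * ?w a \<partial>lborel) \<partial>lborel) \<partial>lborel) =
      (\<integral>\<^sup>+w. e w * (\<integral>\<^sup>+s. ennreal (p (shear_dil_adj 1 1 s w)) \<partial>lborel) +
        e w * (\<integral>\<^sup>+s. (\<integral>\<^sup>+a\<in>A. ?Q w s a * ?w a \<partial>lborel) \<partial>lborel) \<partial>lborel)"
    by (rule nn_integral_add[symmetric]) measurable
  also have "\<dots> = (\<integral>\<^sup>+w. e w \<partial>lborel)"
  proof (rule nn_integral_cong_AE)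
    \<comment> \<open>The shear substitution fails on this null hyperplane.\<close>
    have "AE w in (lborel :: (real ^ 'n option) measure). w $ None \<noteq> 0"
      by (rule AE_head) (rule AE_lborel_singleton)
    then show "AE w in lborel. e w * (\<integral>\<^sup>+s. ennreal (p (shear_dil_adj 1 1 s w)) \<partial>lborel) +
        e w * (\<integral>\<^sup>+s. (\<integral>\<^sup>+a\<in>A. ?Q w s a * ?w a \<partial>lborel) \<partial>lborel) = e w"
      using AE_head[OF calderon]
    proof eventually_elim
      case (elim w)
      have "(\<integral>\<^sup>+s. ennreal (p (shear_dil_adj 1 1 s w)) \<partial>lborel) + (\<integral>\<^sup>+s. (\<integral>\<^sup>+a\<in>A. ?Q w s a * ?w a \<partial>lborel) \<partial>lborel) = 1"
        using nn_integral_shear_parameters[of p w] nn_integral_shear_dil_parameters[of q \<beta> w] \<beta> elim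
        by (simp add: A_def p_def[abs_def] q_def[abs_def])
      then show ?case by (simp add: distrib_left[symmetric])
    qed
  qed
  also have "\<dots> = (\<integral>\<^sup>+y. (cmod (f y))\<^sup>2 \<partial>lborel)"
    unfolding e_def by (rule Plancherel_tame[OF f])
  finally show ?thesis unfolding F_def .
qed

section \<open>Borel representatives\<close>

text \<open>The real-valued statement for completions is applied to real and imaginary parts
  separately.\<close>

lemma lebesgue_borel_representative:
  fixes f :: "'a::euclidean_space \<Rightarrow> complex"
  assumes [measurable]: "f \<in> borel_measurable lebesgue"
  obtains g where "g \<in> borel_measurable borel" "AE x in lborel. f x = g x"
proof -
  have "(\<lambda>x. Re (f x)) \<in> borel_measurable lebesgue" "(\<lambda>x. Im (f x)) \<in> borel_measurable lebesgue"
    by measurable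
  then obtain r i :: "'a \<Rightarrow> real" where [measurable]: "r \<in> borel_measurable lborel" "i \<in> borel_measurable lborel"
    and ae: "AE x in lborel. Re (f x) = r x" "AE x in lborel. Im (f x) = i x"
    using completion_ex_borel_measurable_real by metis
  have "(\<lambda>x. Complex (r x) (i x)) \<in> borel_measurable borel"
    unfolding Complex_eq by measurable
  moreover have "AE x in lborel. f x = Complex (r x) (i x)"
    using ae by eventually_elim (simp add: complex_eq_iff)
  ultimately show ?thesis by (rule that)
qed

lemma L2_representative:
  assumes "f \<in> L2"
  obtains g where "sqint g" "AE x in lborel. f x = g x"
proof -
  have f: "f \<in> borel_measurable lebesgue" "integrable lebesgue (\<lambda>x. (cmod (f x))\<^sup>2)"
    using assms by (auto simp: L2_def)
  obtain g where g: "g \<in> borel_measurable borel" "AE x in lborel. f x = g x"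
    using lebesgue_borel_representative[OF f(1)] .
  have [measurable]: "f \<in> borel_measurable lebesgue" "g \<in> borel_measurable lebesgue"
    using f g by (auto intro: measurable_completion)
  have "integrable lebesgue (\<lambda>x. (cmod (g x))\<^sup>2)"
    using f(2) by (rule integrable_cong_AE_imp) (use g(2) in \<open>auto simp: AE_completion_iff\<close>)
  then have "sqint g" using g(1) by (simp add: sqint_def integrable_completion)
  then show ?thesis using g(2) by (rule that)
qed

lemma L2I_representative:
  assumes "sqint g" "AE x in lborel. f x = g x"
  shows "f \<in> L2"
proof -
  have g: "g \<in> borel_measurable lebesgue" "integrable lebesgue (\<lambda>x. (cmod (g x))\<^sup>2)"
    using assms(1) by (auto simp: sqint_def integrable_completion intro: measurable_completion)
  have ae: "AE x in lebesgue. g x = f x"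
    using assms(2) by (auto simp: AE_completion_iff)
  have f[measurable]: "f \<in> borel_measurable lebesgue" by (rule borel_measurable_AE[OF g(1) ae])
  have "integrable lebesgue (\<lambda>x. (cmod (f x))\<^sup>2)"
    using g(2) by (rule integrable_cong_AE_imp) (use ae in auto)
  with f show ?thesis by (simp add: L2_def)
qed

lemma L2_inner_representative:
  assumes "sqint f'" "AE x in lborel. f x = f' x" "sqint g'" "AE x in lborel. g x = g' x"
  shows "L2_inner f g = (\<integral>x. f' x * cnj (g' x) \<partial>lborel)"
proof -
  note [measurable] = sqintD(1)[OF assms(1)] sqintD(1)[OF assms(3)]
  have "f \<in> borel_measurable lebesgue" "g \<in> borel_measurable lebesgue"
    using L2I_representative assms by (auto simp: L2_def)
  moreover have "f' \<in> borel_measurable lebesgue" "g' \<in> borel_measurable lebesgue"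
    by (auto intro: measurable_completion)
  ultimately have "L2_inner f g = (\<integral>x. f' x * cnj (g' x) \<partial>lebesgue)"
    unfolding L2_inner_def using assms(2,4)
    by (intro integral_cong_AE borel_measurable_times measurable_compose[OF _ cnj_measurable])
      (auto simp: AE_completion_iff elim: eventually_elim2)
  then show ?thesis by (simp add: integral_completion)
qed

lemma sqint_transform:
  fixes T :: "'a::euclidean_space \<Rightarrow> 'a"
  assumes "sqint h" and T: "lborel = density (distr lborel borel T) (\<lambda>_. ennreal c)" "0 < c" "T \<in> borel_measurable borel"
  shows "sqint (\<lambda>x. h (T x))"
proof -
  note [measurable] = sqintD(1)[OF assms(1)] T(3)
  have "(\<lambda>x. h (T x)) \<in> borel_measurable borel" by measurable
  then show ?thesis
    using integrable_lborel_transform[OF T, of "\<lambda>x. (cmod (h x))\<^sup>2"] sqintD(2)[OF assms(1)]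
    by (simp add: sqint_def)
qed

text \<open>Invertible affine maps pull null sets back to null sets, so representatives of the
  generators give representatives of each frame element. The exceptional set depends on
  \<open>p\<close>, which is harmless because each inner product is taken at a fixed
  parameter.\<close>

lemma shearlet_system_representative:
  fixes \<Phi> \<Psi> \<Phi>' \<Psi>' :: "real ^ 'n::finite option \<Rightarrow> complex"
  assumes \<Phi>: "sqint \<Phi>'" "AE x in lborel. \<Phi> x = \<Phi>' x" and \<Psi>: "sqint \<Psi>'" "AE x in lborel. \<Psi> x = \<Psi>' x"
    and p: "p \<in> param_space"
  shows "sqint (shearlet_map \<Phi>' \<Psi>' p)" "AE x in lborel. shearlet_system \<Phi> \<Psi> p x = shearlet_map \<Phi>' \<Psi>' p x"
proof -
  have shift: "lborel = density (distr lborel borel (\<lambda>x. x - t)) (\<lambda>_. ennreal 1)" for t :: "real ^ 'n option"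
  proof -
    have "(\<lambda>x. x - t) = (+) (- t)" by (simp add: fun_eq_iff)
    then show ?thesis by (simp add: lborel_distr_plus density_1)
  qed
  have shear: "sqint (\<lambda>x. h' (shear_dil_inv a b s (x - t)))"
    "AE x in lborel. h (shear_dil_inv a b s (x - t)) = h' (shear_dil_inv a b s (x - t))"
    if "sqint h'" "AE x in lborel. h x = h' x" "a \<noteq> 0" "b \<noteq> 0" for h h' :: "real ^ 'n option \<Rightarrow> complex" and a b s t
  proof -
    note S = lborel_shear_dil_inv[OF that(3,4), of s]
    have pos: "0 < \<bar>1 / a\<bar> * \<bar>1 / b\<bar> ^ CARD('n)" using that by simp
    have m: "shear_dil_inv a b s \<in> borel_measurable borel" by measurable
    show "sqint (\<lambda>x. h' (shear_dil_inv a b s (x - t)))"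
      by (rule sqint_transform[OF sqint_transform[OF that(1) S pos m] shift]) auto
    show "AE x in lborel. h (shear_dil_inv a b s (x - t)) = h' (shear_dil_inv a b s (x - t))"
      by (rule AE_lborel_transform[OF shift _ _ AE_lborel_transform[OF S pos m that(2)]]) auto
  qed
  obtain \<alpha> s t where pe: "p = (\<alpha>, s, t)" by (cases p)
  consider "\<alpha> = \<infinity>" | a where "\<alpha> = ereal a" "a \<noteq> 0"
    using p by (auto simp: pe param_space_def)
  then have "sqint (shearlet_map \<Phi>' \<Psi>' p) \<and> (AE x in lborel. shearlet_system \<Phi> \<Psi> p x = shearlet_map \<Phi>' \<Psi>' p x)"
  proof cases
    case 1
    show ?thesis
      unfolding shearlet_map_eq[OF p] unfolding pe 1 shearlet_system_infinity
      using shear[OF \<Phi>, of 1 1] by simp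
  next
    case 2
    note b = dil_root_nonzero[OF 2(2), of "CARD('n option)"]
    show ?thesis
      unfolding shearlet_map_eq[OF p] unfolding pe 2(1) shearlet_system_finite[OF 2(2)]
      using shear[OF \<Psi> 2(2) b, of s t] by (auto intro: sqint_cmult)
  qed
  then show "sqint (shearlet_map \<Phi>' \<Psi>' p)" "AE x in lborel. shearlet_system \<Phi> \<Psi> p x = shearlet_map \<Phi>' \<Psi>' p x"
    by auto
qed

lemma L1_representative:
  assumes "f \<in> L1" "g \<in> borel_measurable borel" "AE x in lborel. f x = g x"
  shows "integrable lborel g" "fourier f = fourier_L1 g"
proof -
  have f: "integrable lebesgue f" using assms(1) by (simp add: L1_def)
  have g: "g \<in> borel_measurable lebesgue" using assms(2) by (auto intro: measurable_completion)
  have "integrable lebesgue g"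
    using f g by (rule integrable_cong_AE_imp) (use assms(3) in \<open>auto simp: AE_completion_iff\<close>)
  then show "integrable lborel g" using assms(2) by (simp add: integrable_completion)
  have "fourier f = fourier_L1 f" using assms(1) by (simp add: fourier_def fun_eq_iff)
  then show "fourier f = fourier_L1 g"
    using fourier_L1_cong_AE[OF borel_measurable_integrable[OF f] g assms(3)] by simp
qed

theorem theorem3p3:
  fixes \<Phi> \<Psi> :: "real ^ 'n::finite option \<Rightarrow> complex"
  assumes "\<Psi> \<in> L1 \<inter> L2"
    and "admissible_shearlet \<Psi>"
    and "\<Phi> \<in> L1 \<inter> L2"
    and "AE y in lborel.
      (\<integral>\<^sup>+\<sigma>. ennreal ((cmod (fourier \<Phi> (vec_cons y \<sigma>)))\<^sup>2 / \<bar>y\<bar> ^ (CARD('n option) - 1)) \<partial>lborel) +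
      (\<integral>\<^sup>+\<xi>. (\<integral>\<^sup>+\<xi>\<^sub>1\<in>{-\<bar>y\<bar>..\<bar>y\<bar>}.
         ennreal ((cmod (fourier \<Psi> (vec_cons \<xi>\<^sub>1 \<xi>)))\<^sup>2 / \<bar>\<xi>\<^sub>1\<bar> ^ CARD('n option)) \<partial>lborel) \<partial>lborel) = 1"
  shows "continuous_parseval_frame (param_measure :: ('n param) measure) (shearlet_system \<Phi> \<Psi>)"
proof -
  obtain \<Phi>' where \<Phi>': "sqint \<Phi>'" "AE x in lborel. \<Phi> x = \<Phi>' x"
    using L2_representative[of \<Phi>] assms(3) by auto
  obtain \<Psi>' where \<Psi>': "sqint \<Psi>'" "AE x in lborel. \<Psi> x = \<Psi>' x"
    using L2_representative[of \<Psi>] assms(1) by auto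
  note \<Phi>1 = L1_representative[OF _ sqintD(1)[OF \<Phi>'(1)] \<Phi>'(2)]
  note \<Psi>1 = L1_representative[OF _ sqintD(1)[OF \<Psi>'(1)] \<Psi>'(2)]
  let ?M = "param_measure :: ('n param) measure"
  note rep = shearlet_system_representative[OF \<Phi>' \<Psi>']
  have meas: "(\<lambda>p. (cmod (\<integral>y. f y * cnj (shearlet_map \<Phi>' \<Psi>' p y) \<partial>lborel))\<^sup>2) \<in> borel_measurable ?M"
    if "sqint f" for f
    by (intro borel_measurable_param_measureI shearlet_coefficient_measurable sqintD(1) \<Phi>' \<Psi>' that)
  have iso: "(\<integral>\<^sup>+p. (cmod (\<integral>y. f y * cnj (shearlet_map \<Phi>' \<Psi>' p y) \<partial>lborel))\<^sup>2 \<partial>?M) = (\<integral>\<^sup>+y. (cmod (f y))\<^sup>2 \<partial>lborel)"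
    if f: "sqint f" for f
  proof (rule analysis_isometry_from_tame[OF _ meas _ f])
    show "sqint (shearlet_map \<Phi>' \<Psi>' p)" if "p \<in> space ?M" for p
      using rep(1) that by (simp add: space_param_measure)
    fix f :: "real ^ 'n option \<Rightarrow> complex" assume f: "tame f"
    have "(\<integral>\<^sup>+p. (cmod (\<integral>y. f y * cnj (shearlet_map \<Phi>' \<Psi>' p y) \<partial>lborel))\<^sup>2 \<partial>?M) =
        param_integral (\<lambda>p. ennreal ((cmod (\<integral>y. f y * cnj (shearlet_map \<Phi>' \<Psi>' p y) \<partial>lborel))\<^sup>2))"
      by (intro nn_integral_param_measure measurable_compose[OF meas[OF sqint_tame[OF f]] measurable_ennreal])
    also have "\<dots> = (\<integral>\<^sup>+y. (cmod (f y))\<^sup>2 \<partial>lborel)"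
      \<comment> \<open>\<open>fourier\<close> of each generator equals \<open>fourier_L1\<close> of
        its representative as a function, so the normalisation hypothesis transfers
        verbatim.\<close>
      using assms \<Phi>1 \<Psi>1 by (intro tame_param_integral f) auto
    finally show "(\<integral>\<^sup>+p. (cmod (\<integral>y. f y * cnj (shearlet_map \<Phi>' \<Psi>' p y) \<partial>lborel))\<^sup>2 \<partial>?M) =
        (\<integral>\<^sup>+y. (cmod (f y))\<^sup>2 \<partial>lborel)" .
  qed
  show ?thesis
    unfolding continuous_parseval_frame_def
  proof (intro conjI ballI)
    show "shearlet_system \<Phi> \<Psi> p \<in> L2" if "p \<in> space ?M" for p
      using that by (intro L2I_representative[OF rep]) (auto simp: space_param_measure)
    fix f :: "real ^ 'n option \<Rightarrow> complex" assume "f \<in> L2"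
    then obtain f' where f': "sqint f'" "AE x in lborel. f x = f' x" by (rule L2_representative)
    have coeff: "L2_inner f (shearlet_system \<Phi> \<Psi> p) = (\<integral>y. f' y * cnj (shearlet_map \<Phi>' \<Psi>' p y) \<partial>lborel)"
      if "p \<in> space ?M" for p
      using that by (intro L2_inner_representative f' rep) (auto simp: space_param_measure)
    have "L2_norm f ^ 2 = (\<integral>y. (cmod (f y))\<^sup>2 \<partial>lebesgue)"
      by (simp add: L2_norm_def)
    also have "\<dots> = (\<integral>y. (cmod (f' y))\<^sup>2 \<partial>lebesgue)"
      using \<open>f \<in> L2\<close> f' L2I_representative[OF f'(1), of f']
      by (intro integral_cong_AE) (auto simp: L2_def AE_completion_iff)
    also have "\<dots> = (\<integral>y. (cmod (f' y))\<^sup>2 \<partial>lborel)"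
      using sqintD(1)[OF f'(1)] by (intro integral_completion) measurable
    finally have norm: "(L2_norm f)\<^sup>2 = (\<integral>y. (cmod (f' y))\<^sup>2 \<partial>lborel)" .
    \<comment> \<open>The extended identity has a finite right side, so for this nonnegative
      measurable integrand it yields integrability together with the value.\<close>
    have "has_bochner_integral ?M (\<lambda>p. (cmod (\<integral>y. f' y * cnj (shearlet_map \<Phi>' \<Psi>' p y) \<partial>lborel))\<^sup>2) ((L2_norm f)\<^sup>2)"
      using iso[OF f'(1)] sqintD(3)[OF f'(1)]
      by (intro has_bochner_integral_nn_integral meas f') (auto simp: norm)
    then show "has_bochner_integral ?M (\<lambda>p. (cmod (L2_inner f (shearlet_system \<Phi> \<Psi> p)))\<^sup>2) ((L2_norm f)\<^sup>2)"
      by (subst has_bochner_integral_cong[OF refl _ refl]) (auto simp: coeff)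
  qed
qed

end
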